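(* Let $\Gamma=(G,\sigma)$ be a signed graph on $n$ vertices with edge weight $w$, vertex measure $\mu$ and potential $\kappa$, and assume $\kappa\ge 0$ (i.e. $\kappa_i\ge 0$ for all $i$). Let $1<p\le q$ and $1\le k\le n$. Then $$2^{-p}\lambda_k^{(p)}\ \ge\ 2^{-q}\lambda_k^{(q)}$$ and $$p\left(\frac{\lambda_k^{(p)}}{\mathcal D}\right)^{1/p}\ \le\ q\left(\frac{\lambda_k^{(q)}}{\mathcal D}\right)^{1/q},\qquad\text{where } \mathcal D:=\max_{1\le i\le n}\frac{2\kappa_i+\sum_{j\sim i}w_{ij}}{2\mu_i}.$$
   Context: $G=(V,E)$ is a finite undirected graph without self-loops, $V=\{1,\dots,n\}$, and $i\sim j$ means $\{i,j\}\in E$. A signed graph $\Gamma=(G,\sigma)$ has a signature $\sigma:E\to\{+1,-1\}$, $\sigma_{ij}:=\sigma(\{i,j\})$, and comes with an edge weight $w:E\to(0,\infty)$, a vertex measure $\mu:V\to(0,\infty)$ and a potential $\kappa:V\to\mathbb R$ (written $w_{ij},\mu_i,\kappa_i$). For $p\ge1$ and nonzero $f:V\to\mathbb R$, the Rayleigh quotient is $$\mathcal R_p^\sigma(f)=\frac{\sum_{\{i,j\}\in E}w_{ij}|f(i)-\sigma_{ij}f(j)|^p+\sum_{i=1}^n\kappa_i|f(i)|^p}{\sum_{i=1}^n\mu_i|f(i)|^p}.$$ Let $\mathcal S_p=\{f:V\to\mathbb R:\sum_i\mu_i|f(i)|^p=1\}$. For a closed symmetric ($B=-B$) set $B\subset\mathbb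 R^n\setminus\{0\}$, its Krasnoselskii genus $\gamma(B)$ is the least $k$ such that there is an odd continuous map $B\to\mathbb R^k\setminus\{0\}$ ($\infty$ if none). $\mathcal F_k(\mathcal S_p)$ is the family of closed symmetric $B\subset\mathcal S_p$ with $\gamma(B)\ge k$. The $k$-th variational eigenvalue of the $p$-Laplacian of $\Gamma$ is $\lambda_k^{(p)}=\lambda_k^{(p)}(\Gamma)=\min_{B\in\mathcal F_k(\mathcal S_p)}\max_{f\in B}\mathcal R_p^\sigma(f)$, $k=1,\dots,n$. *)

theory Defs
  imports "HOL-Analysis.Analysis" "HOL-Library.Extended_Nat"
begin

text \<open>Vertices are the elements of the finite type 'n (so n = CARD('n)); functions
  f : V -> R are vectors real^'n.  The graph is given by a symmetric irreflexive
  adjacency relation adj; signature sig, weight w are functions on vertex pairs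
  (only their values on edges matter).\<close>

definition signed_graph ::
  "('n::finite \<Rightarrow> 'n \<Rightarrow> bool) \<Rightarrow> ('n \<Rightarrow> 'n \<Rightarrow> real) \<Rightarrow> ('n \<Rightarrow> 'n \<Rightarrow> real)
   \<Rightarrow> ('n \<Rightarrow> real) \<Rightarrow> bool" where
  "signed_graph adj sig w mu \<longleftrightarrow>
     (\<forall>i. \<not> adj i i) \<and> (\<forall>i j. adj i j \<longleftrightarrow> adj j i) \<and>
     (\<forall>i j. adj i j \<longrightarrow> sig i j = sig j i \<and> (sig i j = 1 \<or> sig i j = -1)) \<and>
     (\<forall>i j. adj i j \<longrightarrow> w i j = w j i \<and> w i j > 0) \<and>
     (\<forall>i. mu i > 0)"

text \<open>Sum over undirected edges {i,j} written as half of the sum over ordered adjacent pairs.\<close>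
definition rayleigh ::
  "('n::finite \<Rightarrow> 'n \<Rightarrow> bool) \<Rightarrow> ('n \<Rightarrow> 'n \<Rightarrow> real) \<Rightarrow> ('n \<Rightarrow> 'n \<Rightarrow> real)
   \<Rightarrow> ('n \<Rightarrow> real) \<Rightarrow> ('n \<Rightarrow> real) \<Rightarrow> real \<Rightarrow> real^'n \<Rightarrow> real" where
  "rayleigh adj sig w mu kappa p f =
     ((\<Sum>i\<in>UNIV. \<Sum>j | adj i j. w i j * \<bar>f$i - sig i j * f$j\<bar> powr p) / 2
      + (\<Sum>i\<in>UNIV. kappa i * \<bar>f$i\<bar> powr p))
     / (\<Sum>i\<in>UNIV. mu i * \<bar>f$i\<bar> powr p)"

definition p_sphere :: "('n::finite \<Rightarrow> real) \<Rightarrow> real \<Rightarrow> (real^'n) set" where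
  "p_sphere mu p = {f. (\<Sum>i\<in>UNIV. mu i * \<bar>f$i\<bar> powr p) = 1}"

text \<open>Existence of an odd continuous map B -> R^m \ {0}; R^m is represented as the
  functions nat => real vanishing outside {..<m} (product topology).\<close>
definition odd_map_into :: "(real^'n::finite) set \<Rightarrow> nat \<Rightarrow> bool" where
  "odd_map_into B m \<longleftrightarrow>
     (\<exists>g :: real^'n \<Rightarrow> (nat \<Rightarrow> real). continuous_on B g \<and>
        (\<forall>x\<in>B. g (-x) = (\<lambda>i. - g x i) \<and> g x \<noteq> (\<lambda>i. 0) \<and> (\<forall>i\<ge>m. g x i = 0)))"

definition genus :: "(real^'n::finite) set \<Rightarrow> enat" where
  "genus B = (if \<exists>m. odd_map_into B m then enat (LEAST m. odd_map_into B m) else \<infinity>)"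

definition genus_family :: "('n::finite \<Rightarrow> real) \<Rightarrow> real \<Rightarrow> nat \<Rightarrow> (real^'n) set set" where
  "genus_family mu p k =
     {B. B \<subseteq> p_sphere mu p \<and> closed B \<and> uminus ` B = B \<and> genus B \<ge> enat k}"

definition var_eig ::
  "('n::finite \<Rightarrow> 'n \<Rightarrow> bool) \<Rightarrow> ('n \<Rightarrow> 'n \<Rightarrow> real) \<Rightarrow> ('n \<Rightarrow> 'n \<Rightarrow> real)
   \<Rightarrow> ('n \<Rightarrow> real) \<Rightarrow> ('n \<Rightarrow> real) \<Rightarrow> real \<Rightarrow> nat \<Rightarrow> real" where
  "var_eig adj sig w mu kappa p k =
     Inf ((\<lambda>B. Sup (rayleigh adj sig w mu kappa p ` B)) ` genus_family mu p k)"

definition degD ::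
  "('n::finite \<Rightarrow> 'n \<Rightarrow> bool) \<Rightarrow> ('n \<Rightarrow> 'n \<Rightarrow> real) \<Rightarrow> ('n \<Rightarrow> real) \<Rightarrow> ('n \<Rightarrow> real) \<Rightarrow> real" where
  "degD adj w mu kappa = (MAX i. (2 * kappa i + (\<Sum>j | adj i j. w i j)) / (2 * mu i))"

end

theory Submission
  imports Defs "HOL-Homology.Invariance_of_Domain"
begin

text \<open>The signed power \<open>f \<mapsto> sgn f * \<bar>f\<bar> powr (p / q)\<close> is an odd homeomorphism from \<open>S\<^sub>p\<close> onto \<open>S\<^sub>q\<close>, so it
  maps the sets of genus at least \<open>k\<close> on one sphere to those on the other, and it suffices to compare
  Rayleigh quotients pointwise. The first inequality follows edge by edge from
  \<open>\<bar>spow r a - spow r b\<bar> / 2 \<le> (\<bar>a - b\<bar> / 2) powr r\<close> for \<open>r = p / q \<le> 1\<close>. The second follows from the mean value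
  estimate \<open>\<bar>spow s a - spow s b\<bar> \<le> s * \<bar>a - b\<bar> * ((\<bar>a\<bar> powr q + \<bar>b\<bar> powr q) / 2) powr (1/p - 1/q)\<close> for
  \<open>s = q / p\<close>, summed with Hoelder's inequality.

  The infimum over an empty family would be a junk value, so one also needs that \<open>S\<^sub>p\<close> itself has genus
  at least \<open>n\<close>. This is the Borsuk-Ulam theorem: odd self-maps of spheres have odd degree, by induction
  on the dimension, since every odd map is homotopic (up to a reflection) to one that preserves the equator.\<close>

section \<open>The Borsuk-Ulam theorem\<close>

text \<open>The spheres \<open>nsphere m\<close> live in \<open>nat => real\<close>; a fixed
  enumeration of the basis translates between them and the Euclidean space.\<close>

locale basis_enumeration =
  fixes b :: "nat \<Rightarrow> 'a::euclidean_space"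
  assumes bij: "bij_betw b {..<DIM('a)} Basis"
begin

definition vec_of :: "(nat \<Rightarrow> real) \<Rightarrow> 'a" where
  "vec_of x = (\<Sum>i<DIM('a). x i *\<^sub>R b i)"

definition coords :: "'a \<Rightarrow> nat \<Rightarrow> real" where
  "coords v = (\<lambda>i. if i < DIM('a) then v \<bullet> b i else 0)"

text \<open>\<^term>\<open>flat k\<close> is the span of the first \<open>k\<close> basis vectors, so that
  \<^term>\<open>flat_sphere m\<close> is a copy of the \<open>m\<close>-sphere inside the fixed space \<^typ>\<open>'a\<close>; induction on
  the dimension of the sphere then needs no change of type.\<close>

definition flat :: "nat \<Rightarrow> 'a set" where
  "flat k = {v. \<forall>i\<in>{k..<DIM('a)}. v \<bullet> b i = 0}"

definition flat_sphere :: "nat \<Rightarrow> 'a set" where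
  "flat_sphere m = sphere 0 1 \<inter> flat (Suc m)"

text \<open>Conjugation with the coordinate maps carries the Brouwer degree from
  \<open>nsphere m\<close> to \<open>flat_sphere m\<close>; this is meaningful for
  \<open>m < DIM('a)\<close>.\<close>

definition deg :: "nat \<Rightarrow> ('a \<Rightarrow> 'a) \<Rightarrow> int" where
  "deg m F = Brouwer_degree2 m (coords \<circ> F \<circ> vec_of)"

section \<open>Coordinates and coordinate subspaces\<close>

lemma b_in_Basis [simp]: "i < DIM('a) \<Longrightarrow> b i \<in> Basis"
  using bij by (auto simp: bij_betw_def)

lemma Basis_ball_iff: "(\<forall>c\<in>Basis. P c) \<longleftrightarrow> (\<forall>i<DIM('a). P (b i))"
  using bij_betw_imp_surj_on[OF bij] by (metis b_in_Basis imageE lessThan_iff)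

lemma inj_b: "inj_on b {..<DIM('a)}"
  using bij by (auto simp: bij_betw_def)

lemma inner_b: "i < DIM('a) \<Longrightarrow> j < DIM('a) \<Longrightarrow> b i \<bullet> b j = (if i = j then 1 else 0)"
  using inj_b by (auto simp: inner_Basis inj_on_def)

lemma vec_of_inner: "i < DIM('a) \<Longrightarrow> vec_of x \<bullet> b i = x i"
  by (simp add: vec_of_def inner_sum_left inner_b if_distrib cong: if_cong)

lemma vec_of_coords [simp]: "vec_of (coords v) = v"
  unfolding euclidean_eq_iff[of _ v] Basis_ball_iff by (simp add: vec_of_inner coords_def)

lemma norm_power2_eq: "(norm v)\<^sup>2 = (\<Sum>i<DIM('a). (v \<bullet> b i)\<^sup>2)"
proof -
  have "(norm v)\<^sup>2 = (\<Sum>c\<in>Basis. (v \<bullet> c)\<^sup>2)"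
    by (subst power2_norm_eq_inner, subst euclidean_inner) (simp only: power2_eq_square)
  also have "\<dots> = (\<Sum>i<DIM('a). (v \<bullet> b i)\<^sup>2)"
    by (rule sum.reindex_bij_betw[OF bij, symmetric])
  finally show ?thesis .
qed

lemma subspace_flat [simp]: "subspace (flat k)"
  by (auto simp: flat_def subspace_def inner_add_left)

lemma flat_mono: "j \<le> k \<Longrightarrow> flat j \<subseteq> flat k"
  by (auto simp: flat_def)

lemma flat_SucD:
  assumes "v \<in> flat (Suc k)" "v \<bullet> b k = 0"
  shows "v \<in> flat k"
  unfolding flat_def
proof (intro CollectI ballI)
  fix i assume "i \<in> {k..<DIM('a)}"
  then show "v \<bullet> b i = 0"
    using assms by (cases "i = k") (auto simp: flat_def)
qed

lemma dim_flat: "k \<le> DIM('a) \<Longrightarrow> dim (flat k) = k"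
proof -
  assume k: "k \<le> DIM('a)"
  have "b i \<notin> b ` {..<k} \<longleftrightarrow> k \<le> i" if "i < DIM('a)" for i
    using that k inj_on_eq_iff[OF inj_b] by (force simp: not_less)
  then have "flat k = {x. \<forall>i\<in>Basis. i \<notin> b ` {..<k} \<longrightarrow> x \<bullet> i = 0}"
    unfolding flat_def Basis_ball_iff by auto
  moreover have "b ` {..<k} \<subseteq> Basis"
    using k by auto
  moreover have "card (b ` {..<k}) = k"
    using k inj_b by (subst card_image) (auto intro: inj_on_subset)
  ultimately show ?thesis
    using dim_substandard[of "b ` {..<k}"] by (simp only:)
qed

lemma flat_sphere_mono: "j \<le> k \<Longrightarrow> flat_sphere j \<subseteq> flat_sphere k"
  using flat_mono by (force simp: flat_sphere_def)

lemma compact_flat_sphere: "compact (flat_sphere m)"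
  by (simp add: flat_sphere_def closed_subspace compact_Int_closed)

lemma uminus_flat_sphere: "x \<in> flat_sphere m \<Longrightarrow> - x \<in> flat_sphere m"
  by (auto simp: flat_sphere_def subspace_neg)

lemma sgn_flat_sphere: "v \<in> flat (Suc m) \<Longrightarrow> v \<noteq> 0 \<Longrightarrow> sgn v \<in> flat_sphere m"
  by (auto simp: flat_sphere_def norm_sgn sgn_div_norm intro: subspace_scale)

section \<open>Transport between \<open>nsphere m\<close> and \<open>flat_sphere m\<close>\<close>

lemma nsphere_eq: "nsphere m = top_of_set {x. (\<Sum>i\<le>m. x i ^ 2) = 1 \<and> (\<forall>i>m. x i = 0)}"
  by (simp add: nsphere euclidean_product_topology)

lemma topspace_nsphere_eq: "topspace (nsphere m) = {x. (\<Sum>i\<le>m. x i ^ 2) = 1 \<and> (\<forall>i>m. x i = 0)}"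
  by (simp add: nsphere_eq)

lemma vec_of_in:
  assumes m: "m < DIM('a)" and x: "x \<in> topspace (nsphere m)"
  shows "vec_of x \<in> flat_sphere m"
proof -
  have "(norm (vec_of x))\<^sup>2 = (\<Sum>i<DIM('a). (x i)\<^sup>2)"
    by (simp add: norm_power2_eq vec_of_inner)
  also have "\<dots> = (\<Sum>i\<le>m. (x i)\<^sup>2)"
    using m x by (intro sum.mono_neutral_right) (auto simp: topspace_nsphere_eq)
  finally have "(norm (vec_of x))\<^sup>2 = 1"
    using x by (simp add: topspace_nsphere_eq)
  then have "norm (vec_of x) = 1"
    by (simp add: power2_eq_1_iff) (smt (verit) norm_ge_zero)
  then show ?thesis
    using x by (auto simp: flat_sphere_def flat_def topspace_nsphere_eq vec_of_inner)
qed

lemma coords_in: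
  assumes m: "m < DIM('a)" and v: "v \<in> flat_sphere m"
  shows "coords v \<in> topspace (nsphere m)"
proof -
  have "(\<Sum>i\<le>m. (coords v i)\<^sup>2) = (\<Sum>i<DIM('a). (v \<bullet> b i)\<^sup>2)"
    using m v by (intro sum.mono_neutral_cong_left) (auto simp: flat_sphere_def flat_def coords_def)
  then show ?thesis
    using v norm_power2_eq[of v] by (auto simp: topspace_nsphere_eq flat_sphere_def flat_def coords_def)
qed

lemma coords_vec_of:
  assumes m: "m < DIM('a)" and x: "x \<in> topspace (nsphere m)"
  shows "coords (vec_of x) = x"
  using assms by (auto simp: coords_def vec_of_inner topspace_nsphere_eq)

lemma continuous_on_vec_of: "continuous_on X vec_of"
proof -
  have "continuous_on X (\<lambda>x. x i)" for i :: nat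
    by (rule continuous_on_subset[OF continuous_on_product_coordinates]) simp
  then show ?thesis
    unfolding vec_of_def by (intro continuous_on_sum continuous_on_scaleR continuous_on_const)
qed

lemma continuous_on_coords: "continuous_on X coords"
  unfolding coords_def
proof (rule continuous_on_coordinatewise_then_product)
  show "continuous_on X (\<lambda>x. if i < DIM('a) then x \<bullet> b i else 0)" for i
    by (cases "i < DIM('a)") (auto intro: continuous_intros)
qed

lemma continuous_map_vec_of:
  "m < DIM('a) \<Longrightarrow> continuous_map (nsphere m) (top_of_set (flat_sphere m)) vec_of"
  using vec_of_in[of m] by (auto simp: nsphere_eq continuous_on_vec_of)

lemma continuous_map_coords:
  "m < DIM('a) \<Longrightarrow> continuous_map (top_of_set (flat_sphere m)) (nsphere m) coords"
  using coords_in[of m] by (auto simp: nsphere_eq continuous_on_coords)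

section \<open>Degree of self-maps of \<open>flat_sphere m\<close>\<close>

lemma deg_eq:
  assumes "m < DIM('a)" "\<And>x. x \<in> flat_sphere m \<Longrightarrow> F x = G x"
  shows "deg m F = deg m G"
  unfolding deg_def using assms by (intro Brouwer_degree2_eq) (auto simp: vec_of_in)

lemma deg_id: "m < DIM('a) \<Longrightarrow> deg m id = 1"
proof -
  assume m: "m < DIM('a)"
  have "Brouwer_degree2 m (coords \<circ> id \<circ> vec_of) = Brouwer_degree2 m id"
    using m by (intro Brouwer_degree2_eq) (auto simp: coords_vec_of)
  then show ?thesis
    by (simp add: deg_def)
qed

lemma continuous_map_conj:
  assumes m: "m < DIM('a)" and F: "continuous_on (flat_sphere m) F" "F \<in> flat_sphere m \<rightarrow> flat_sphere m"
  shows "continuous_map (nsphere m) (nsphere m) (coords \<circ> F \<circ> vec_of)"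
proof -
  have "continuous_map (top_of_set (flat_sphere m)) (top_of_set (flat_sphere m)) F"
    using F by auto
  from continuous_map_compose[OF continuous_map_vec_of[OF m] continuous_map_compose[OF this continuous_map_coords[OF m]]]
  show ?thesis
    by (simp only: comp_assoc)
qed

lemma deg_compose:
  assumes m: "m < DIM('a)" and F: "continuous_on (flat_sphere m) F" "F \<in> flat_sphere m \<rightarrow> flat_sphere m"
    and G: "continuous_on (flat_sphere m) G" "G \<in> flat_sphere m \<rightarrow> flat_sphere m"
  shows "deg m (G \<circ> F) = deg m G * deg m F"
proof -
  have "coords \<circ> (G \<circ> F) \<circ> vec_of = (coords \<circ> G \<circ> vec_of) \<circ> (coords \<circ> F \<circ> vec_of)"
    by (rule ext) (simp only: comp_apply vec_of_coords)
  then show ?thesis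
    unfolding deg_def
    by (simp only: Brouwer_degree2_compose[OF continuous_map_conj[OF m F] continuous_map_conj[OF m G]])
qed

lemma odd_deg_involution:
  assumes m: "m < DIM('a)" and F: "continuous_on (flat_sphere m) F" "F \<in> flat_sphere m \<rightarrow> flat_sphere m"
    and inv: "\<And>x. x \<in> flat_sphere m \<Longrightarrow> F (F x) = x"
  shows "odd (deg m F)"
proof -
  have "deg m F * deg m F = deg m (F \<circ> F)"
    using deg_compose[OF m F F] by simp
  also have "\<dots> = deg m id"
    using inv by (intro deg_eq m) auto
  finally have "odd (deg m F * deg m F)"
    using m by (simp add: deg_id)
  then show ?thesis by simp
qed

lemma deg_homotopic:
  assumes m: "m < DIM('a)"
    and "homotopic_with_canon (\<lambda>_. True) (flat_sphere m) (flat_sphere m) F G"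
  shows "deg m F = deg m G"
proof -
  have "homotopic_with (\<lambda>_. True) (nsphere m) (top_of_set (flat_sphere m)) (F \<circ> vec_of) (G \<circ> vec_of)"
    using homotopic_with_compose_continuous_map_right[OF assms(2) continuous_map_vec_of[OF m]] by simp
  then have "homotopic_with (\<lambda>_. True) (nsphere m) (nsphere m) (coords \<circ> (F \<circ> vec_of)) (coords \<circ> (G \<circ> vec_of))"
    by (rule homotopic_with_compose_continuous_map_left[OF _ continuous_map_coords[OF m]]) simp
  then show ?thesis
    unfolding deg_def comp_assoc by (rule Brouwer_degree2_homotopic)
qed

text \<open>The straight-line homotopy from \<open>F\<close> to \<open>G\<close> stays in the
  subspace and avoids 0, so composing it with \<open>sgn\<close> gives a homotopy inside the
  sphere.\<close>

lemma deg_sgn_segment: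
  assumes m: "m < DIM('a)"
    and F: "continuous_on (flat_sphere m) F" "F \<in> flat_sphere m \<rightarrow> flat (Suc m)"
    and G: "continuous_on (flat_sphere m) G" "G \<in> flat_sphere m \<rightarrow> flat (Suc m)"
    and seg: "\<And>x. x \<in> flat_sphere m \<Longrightarrow> 0 \<notin> closed_segment (F x) (G x)"
  shows "deg m (sgn \<circ> F) = deg m (sgn \<circ> G)"
proof (rule deg_homotopic[OF m])
  have hom: "homotopic_with_canon (\<lambda>_. True) (flat_sphere m) (flat (Suc m) - {0}) F G"
  proof (rule homotopic_with_linear[OF F(1) G(1)])
    fix x assume x: "x \<in> flat_sphere m"
    have "closed_segment (F x) (G x) \<subseteq> flat (Suc m)"
      using F(2) G(2) x by (intro closed_segment_subset subspace_imp_convex) auto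
    then show "closed_segment (F x) (G x) \<subseteq> flat (Suc m) - {0}"
      using seg[OF x] by auto
  qed
  have "continuous_map (top_of_set (flat (Suc m) - {0})) (top_of_set (flat_sphere m)) sgn"
    by (auto intro!: continuous_intros sgn_flat_sphere)
  with hom show "homotopic_with_canon (\<lambda>_. True) (flat_sphere m) (flat_sphere m) (sgn \<circ> F) (sgn \<circ> G)"
    by (rule homotopic_with_compose_continuous_map_left) auto
qed

lemma deg_nonsurjective:
  assumes m: "m < DIM('a)" and F: "continuous_on (flat_sphere m) F" "F \<in> flat_sphere m \<rightarrow> flat_sphere m"
    and v: "v \<in> flat_sphere m" "v \<notin> F ` flat_sphere m"
  shows "deg m F = 0"
  unfolding deg_def
proof (rule Brouwer_degree2_nonsurjective[OF continuous_map_conj[OF m F]])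
  have "coords v \<notin> (coords \<circ> F \<circ> vec_of) ` topspace (nsphere m)"
  proof
    assume "coords v \<in> (coords \<circ> F \<circ> vec_of) ` topspace (nsphere m)"
    then obtain x where x: "x \<in> topspace (nsphere m)" "coords v = coords (F (vec_of x))"
      by auto
    then have "v = F (vec_of x)"
      by (metis vec_of_coords)
    with v(2) vec_of_in[OF m x(1)] show False by auto
  qed
  with coords_in[OF m v(1)]
  show "(coords \<circ> F \<circ> vec_of) ` topspace (nsphere m) \<noteq> topspace (nsphere m)"
    by auto
qed

section \<open>Odd self-maps of spheres have odd degree\<close>

lemma coords_uminus: "coords (- v) = (\<lambda>i. - coords v i)"
  by (auto simp: coords_def)

lemma vec_of_uminus: "vec_of (\<lambda>i. - x i) = - vec_of x"
  by (auto simp: vec_of_def sum_negf)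

text \<open>Borsuk's parity step, carried over by the coordinate maps. That \<open>F\<close>
  preserves the equator is what the induction below has to arrange.\<close>

lemma even_deg_step:
  assumes m: "Suc m < DIM('a)"
    and F: "continuous_on (flat_sphere (Suc m)) F" "F \<in> flat_sphere (Suc m) \<rightarrow> flat_sphere (Suc m)"
    and eq: "F \<in> flat_sphere m \<rightarrow> flat_sphere m"
    and oddF: "\<And>x. x \<in> flat_sphere (Suc m) \<Longrightarrow> F (- x) = - F x"
  shows "even (deg (Suc m) F - deg m F)"
proof -
  have "even (Brouwer_degree2 (Suc m) (coords \<circ> F \<circ> vec_of)
      - Brouwer_degree2 (Suc m - Suc 0) (coords \<circ> F \<circ> vec_of))"
  proof (rule Borsuk_odd_mapping_degree_step[OF continuous_map_conj[OF m F]])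
    show "((coords \<circ> F \<circ> vec_of) \<circ> (\<lambda>x i. - x i)) u = ((\<lambda>x i. - x i) \<circ> (coords \<circ> F \<circ> vec_of)) u"
      if "u \<in> topspace (nsphere (Suc m))" for u
      using vec_of_in[OF m that] by (simp add: vec_of_uminus oddF coords_uminus)
    show "coords \<circ> F \<circ> vec_of
        \<in> topspace (nsphere (Suc m - Suc 0)) \<rightarrow> topspace (nsphere (Suc m - Suc 0))"
      using m eq vec_of_in[of m] by (auto simp: Pi_iff intro!: coords_in)
  qed
  then show ?thesis
    by (simp add: deg_def)
qed

text \<open>The 0-sphere consists of \<open>b 0\<close> and \<open>- b 0\<close>, so an odd self-map
  is the identity or the antipodal map, and both are involutions.\<close>

lemma odd_deg_0:
  assumes F: "continuous_on (flat_sphere 0) F" "F \<in> flat_sphere 0 \<rightarrow> flat_sphere 0"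
    and oddF: "\<And>x. x \<in> flat_sphere 0 \<Longrightarrow> F (- x) = - F x"
  shows "odd (deg 0 F)"
proof (rule odd_deg_involution[OF _ F])
  have mem: "x = b 0 \<or> x = - b 0" if x: "x \<in> flat_sphere 0" for x
  proof -
    have eq: "x \<bullet> b i = ((x \<bullet> b 0) *\<^sub>R b 0) \<bullet> b i" if "i < DIM('a)" for i
      using x that by (cases "i = 0") (auto simp: flat_sphere_def flat_def inner_b)
    have x0: "x = (x \<bullet> b 0) *\<^sub>R b 0"
      by (rule iffD2[OF euclidean_eq_iff], unfold Basis_ball_iff) (use eq in blast)
    have "norm x = \<bar>x \<bullet> b 0\<bar>"
      using arg_cong[OF x0, of norm] by (simp add: norm_Basis)
    then have "\<bar>x \<bullet> b 0\<bar> = 1"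
      using x by (simp add: flat_sphere_def)
    then have "x \<bullet> b 0 = 1 \<or> x \<bullet> b 0 = -1"
      by linarith
    then show ?thesis
      using x0 by auto
  qed
  have b0: "b 0 \<in> flat_sphere 0"
    by (auto simp: flat_sphere_def flat_def inner_b norm_Basis)
  fix x assume x: "x \<in> flat_sphere 0"
  have "F (b 0) = b 0 \<or> F (b 0) = - b 0"
    using F(2) b0 mem by blast
  then show "F (F x) = x"
    using mem[OF x] oddF[OF b0] by auto
qed simp

text \<open>In the inductive step \<open>F\<close> is deformed to \<open>sgn o h\<close> with
  \<open>h\<close> smooth and odd, then to \<open>sgn o k\<close> with \<open>k\<close> orthogonal
  to a missed direction \<open>v\<close> on the equator. A reflection taking \<open>v\<close> to the
  pole then yields a map \<open>G\<close> that preserves the equator, to which the parity step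
  applies.\<close>

lemma odd_deg_odd_map:
  assumes "m < DIM('a)" "continuous_on (flat_sphere m) F" "F \<in> flat_sphere m \<rightarrow> flat_sphere m"
    and "\<And>x. x \<in> flat_sphere m \<Longrightarrow> F (- x) = - F x"
  shows "odd (deg m F)"
  using assms
proof (induction m arbitrary: F)
  case 0
  then show ?case by (intro odd_deg_0)
next
  case (Suc m)
  let ?S = "flat_sphere (Suc m)" and ?T = "flat (Suc (Suc m))"
  note m = Suc.prems(1) and contF = Suc.prems(2) and FS = Suc.prems(3) and oddF = Suc.prems(4)
  have ST: "?S \<subseteq> ?T"
    by (auto simp: flat_sphere_def)
  have "F ` ?S \<subseteq> ?T"
    using FS ST by auto
  then obtain g where g: "polynomial_function g" "g ` ?S \<subseteq> ?T" "\<And>x. x \<in> ?S \<Longrightarrow> norm (F x - g x) < 1"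
    using Stone_Weierstrass_polynomial_function_subspace[OF compact_flat_sphere contF zero_less_one subspace_flat]
    by metis
  \<comment> \<open>A smooth odd map cannot fill \<^term>\<open>?S\<close> with the image of the equator, so replace \<^term>\<open>F\<close> by
    the odd part of a polynomial approximation.\<close>
  define h where "h = (\<lambda>x. (1/2) *\<^sub>R (g x - g (- x)))"
  have "polynomial_function h"
  proof -
    have "polynomial_function (\<lambda>x::'a. - x)"
      by (intro polynomial_function_minus polynomial_function_id[unfolded id_def])
    then have "polynomial_function (g \<circ> (\<lambda>x. - x))"
      using g(1) by (rule polynomial_function_compose)
    then show ?thesis
      unfolding h_def using g(1)
      by (intro polynomial_function_cmul polynomial_function_diff) (simp_all add: o_def)
  qed
  then have diffh: "h differentiable_on X" for X
    by (rule differentiable_on_polynomial_function)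
  then have conth: "continuous_on X h" for X
    by (rule differentiable_imp_continuous_on)
  have oddh: "h (- x) = - h x" for x
    by (simp add: h_def algebra_simps)
  have hT: "h \<in> ?S \<rightarrow> ?T"
    using g(2) uminus_flat_sphere unfolding h_def
    by (intro Pi_I subspace_scale subspace_diff subspace_flat) auto
  have near: "norm (h x - F x) < 1" if x: "x \<in> ?S" for x
  proof -
    \<comment> \<open>An odd map is its own odd part, so passing to the odd part of \<open>g\<close>
      merely averages two errors below 1.\<close>
    have "h x - F x = (1/2) *\<^sub>R ((F (- x) - g (- x)) - (F x - g x))"
      using oddF[OF x] by (simp add: h_def algebra_simps flip: scaleR_add_left)
    also have "norm \<dots> \<le> (1/2) * (norm (F (- x) - g (- x)) + norm (F x - g x))"
      using norm_triangle_ineq4[of "F (- x) - g (- x)" "F x - g x"] by simp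
    also have "\<dots> < 1"
      using g(3)[OF x] g(3)[OF uminus_flat_sphere[OF x]] by simp
    finally show ?thesis .
  qed
  have normF: "norm (F x) = 1" if "x \<in> ?S" for x
    using FS that by (auto simp: flat_sphere_def)
  have h0: "h x \<noteq> 0" if "x \<in> ?S" for x
    using near[OF that] normF[OF that] by auto
  have "deg (Suc m) F = deg (Suc m) (sgn \<circ> F)"
    using normF by (intro deg_eq m) (simp add: sgn_div_norm)
  also have "\<dots> = deg (Suc m) (sgn \<circ> h)"
  proof (rule deg_sgn_segment[OF m contF _ conth hT])
    \<comment> \<open>Every point of the segment is at distance less than 1 from \<open>F x\<close>,
      which has norm 1.\<close>
    show "0 \<notin> closed_segment (F x) (h x)" if x: "x \<in> ?S" for x
      using segment_bound(1)[of 0 "F x" "h x"] near[OF x] normF[OF x] by auto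
  qed (use FS ST in auto)
  finally have deg1: "deg (Suc m) F = deg (Suc m) (sgn \<circ> h)" .

  have equator: "flat_sphere m \<subseteq> ?S"
    by (rule flat_sphere_mono) simp
  have sgnh: "(sgn \<circ> h) ` flat_sphere m \<subseteq> ?S"
    using equator hT h0 by (auto intro!: sgn_flat_sphere)
  have "(sgn \<circ> h) differentiable_on flat_sphere m"
  proof -
    have "(\<lambda>x. inverse (norm (h x)) *\<^sub>R h x) differentiable_on flat_sphere m"
      using h0 equator
      by (fastforce intro: derivative_intros diffh differentiable_on_compose[OF diffh])
    then show ?thesis
      by (simp add: o_def sgn_div_norm)
  qed
  \<comment> \<open>The equator spans a subspace of smaller dimension, and a differentiable map
    cannot cover the larger sphere from there.\<close>
  then have "(sgn \<circ> h) ` flat_sphere m \<noteq> ?S"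
    unfolding flat_sphere_def using m flat_mono[of "Suc m" "Suc (Suc m)"]
    by (intro spheremap_lemma1) (simp_all add: dim_flat)
  with sgnh obtain v where v: "v \<in> ?S" "v \<notin> (sgn \<circ> h) ` flat_sphere m"
    by blast
  have vv: "v \<bullet> v = 1"
    using v(1) by (simp add: flat_sphere_def dot_square_norm)
  \<comment> \<open>Project away from the missed direction \<^term>\<open>v\<close>, fully on the equator and not at all at the
    poles; the cut-off is even, so the map stays odd.\<close>
  define c where "c = (\<lambda>x. 1 - \<bar>x \<bullet> b (Suc m)\<bar>)"
  define k where "k = (\<lambda>x. h x - (c x * (h x \<bullet> v)) *\<^sub>R v)"
  have c01: "0 \<le> c x" "c x \<le> 1" if "x \<in> ?S" for x
  proof -
    have "norm (b (Suc m)) = 1"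
      using m by (simp add: norm_Basis)
    then show "0 \<le> c x" "c x \<le> 1"
      using that Cauchy_Schwarz_ineq2[of x "b (Suc m)"] by (auto simp: c_def flat_sphere_def)
  qed
  have c1: "x \<in> flat_sphere m" if "x \<in> ?S" "c x = 1" for x
    using that by (auto simp: c_def flat_sphere_def intro: flat_SucD)
  have c1': "c x = 1" if "x \<in> flat_sphere m" for x
    using that m by (auto simp: c_def flat_sphere_def flat_def)
  have missed: "h x \<noteq> r *\<^sub>R v" if x: "x \<in> flat_sphere m" for x r
  proof
    assume eq: "h x = r *\<^sub>R v"
    have "r \<noteq> 0"
      using h0[of x] x equator eq by auto
    moreover have "sgn v = v"
      using v(1) by (simp add: flat_sphere_def sgn_div_norm)
    \<comment> \<open>If \<open>r\<close> is negative, oddness moves the collision to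
      \<open>- x\<close>, which is also on the equator.\<close>
    ultimately have "sgn (h x) = v \<or> sgn (h (- x)) = v"
      by (cases "r > 0") (auto simp: oddh eq sgn_scaleR sgn_minus)
    then show False
      using v(2) x uminus_flat_sphere[OF x] by force
  qed
  have contk: "continuous_on X k" for X
    unfolding k_def c_def by (intro continuous_intros conth)
  have vT: "v \<in> ?T"
    using v(1) ST by blast
  have kT: "k \<in> ?S \<rightarrow> ?T"
    using hT vT unfolding k_def
    by (intro Pi_I subspace_diff subspace_scale subspace_flat) auto
  have oddk: "k (- x) = - k x" for x
    by (simp add: k_def c_def oddh)
  \<comment> \<open>A zero on the segment makes \<open>h x\<close> a multiple of \<open>v\<close>
    and forces \<open>s * c x = 1\<close>. Both factors are at most 1, so \<open>c x = 1\<close>: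
    the point is on the equator, where \<open>h\<close> misses the line of \<open>v\<close>.\<close>
  have seg: "0 \<notin> closed_segment (h x) (k x)" if x: "x \<in> ?S" for x
  proof
    assume "0 \<in> closed_segment (h x) (k x)"
    then obtain s where s: "0 \<le> s" "s \<le> 1" "0 = (1 - s) *\<^sub>R h x + s *\<^sub>R k x"
      by (auto simp: closed_segment_def)
    then have eq: "h x = (s * c x * (h x \<bullet> v)) *\<^sub>R v"
      by (simp add: k_def algebra_simps)
    have "h x \<bullet> v = s * c x * (h x \<bullet> v)"
      using arg_cong[OF eq, of "\<lambda>y. y \<bullet> v"] vv by simp
    moreover have "h x \<bullet> v \<noteq> 0"
      using eq h0[OF x] by auto
    ultimately have "s * c x = 1"
      by (metis mult_cancel_right1)
    with s c01[OF x] have "c x = 1"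
      by (smt (verit) mult_left_le_one_le mult_right_le_one_le)
    then show False
      using missed[OF c1[OF x]] eq by blast
  qed
  have k0: "k x \<noteq> 0" if "x \<in> ?S" for x
    using seg[OF that] by auto
  have deg2: "deg (Suc m) (sgn \<circ> h) = deg (Suc m) (sgn \<circ> k)"
    by (rule deg_sgn_segment[OF m conth hT contk kT seg])

  \<comment> \<open>The reflection exchanging \<^term>\<open>v\<close> and the pole; for \<open>u = 0\<close> the junk value \<open>x / 0 = 0\<close> makes it
    the identity, as needed.\<close>
  define u where "u = v - b (Suc m)"
  define R where "R = (\<lambda>y. y - (2 * (y \<bullet> u) / (u \<bullet> u)) *\<^sub>R u)"
  have bS: "b (Suc m) \<in> ?S"
    using m by (auto simp: flat_sphere_def flat_def inner_b norm_Basis)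
  have uT: "u \<in> ?T"
    using vT bS ST by (auto simp: u_def intro!: subspace_diff)
  have Ru: "R y \<bullet> u = - (y \<bullet> u)" for y
    by (cases "u = 0") (auto simp: R_def inner_diff_left)
  have RR: "R (R y) = y" for y
  proof -
    have "R (R y) = R y - (2 * (R y \<bullet> u) / (u \<bullet> u)) *\<^sub>R u"
      by (simp add: R_def)
    then show ?thesis
      unfolding Ru by (simp add: R_def)
  qed
  have normR: "norm (R y) = norm y" for y
  proof -
    have "R y \<bullet> R y = R y \<bullet> y - (2 * (y \<bullet> u) / (u \<bullet> u)) * (R y \<bullet> u)"
      by (subst (2) R_def) (simp add: inner_diff_right)
    also have "\<dots> = y \<bullet> y"
      unfolding Ru by (simp add: R_def inner_diff_left inner_diff_right inner_commute)
    finally show ?thesis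
      by (simp add: norm_eq)
  qed
  have RS: "R \<in> ?S \<rightarrow> ?S"
  proof
    fix y assume y: "y \<in> ?S"
    then have "R y \<in> ?T"
      unfolding R_def using uT ST by (intro subspace_diff subspace_scale subspace_flat) auto
    then show "R y \<in> ?S"
      using y by (simp add: flat_sphere_def normR)
  qed
  have contR: "continuous_on X R" for X
    unfolding R_def divide_inverse by (intro continuous_intros)
  have oddR: "R (- y) = - R y" for y
    by (simp add: R_def)
  \<comment> \<open>\<open>R\<close> is symmetric and exchanges \<open>v\<close> with the pole, so
    orthogonality to \<open>v\<close> before applying \<open>R\<close> becomes orthogonality to the
    pole afterwards.\<close>
  have Rb: "R y \<bullet> b (Suc m) = y \<bullet> v" for y
  proof (cases "u = 0")
    case True
    then show ?thesis by (simp add: R_def u_def)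
  next
    case False
    have "u \<bullet> u = - 2 * (u \<bullet> b (Suc m))"
      using vv m by (simp add: u_def inner_diff_left inner_diff_right inner_commute inner_b)
    moreover have "u \<bullet> u \<noteq> 0"
      using False by simp
    moreover have "R y \<bullet> b (Suc m) = y \<bullet> b (Suc m) - 2 * (y \<bullet> u) / (u \<bullet> u) * (u \<bullet> b (Suc m))"
      by (simp add: R_def inner_diff_left)
    ultimately have "R y \<bullet> b (Suc m) = y \<bullet> b (Suc m) + y \<bullet> u"
      by (simp add: field_simps)
    then show ?thesis
      by (simp add: u_def inner_diff_right)
  qed
  define G where "G = R \<circ> (sgn \<circ> k)"
  have sgnk: "continuous_on ?S (sgn \<circ> k)" "sgn \<circ> k \<in> ?S \<rightarrow> ?S"
    using contk k0 kT by (auto simp: o_def intro!: continuous_intros sgn_flat_sphere)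
  have contG: "continuous_on ?S G"
    unfolding G_def by (rule continuous_on_compose[OF sgnk(1) contR])
  have GS: "G \<in> ?S \<rightarrow> ?S"
    unfolding G_def using sgnk(2) RS by (auto simp: Pi_iff)
  have oddG: "G (- x) = - G x" for x
    by (simp add: G_def oddk sgn_minus oddR)
  have Geq: "G \<in> flat_sphere m \<rightarrow> flat_sphere m"
  proof
    fix x assume x: "x \<in> flat_sphere m"
    have "k x \<bullet> v = 0"
      using c1'[OF x] vv by (simp add: k_def inner_diff_left)
    then have "G x \<bullet> b (Suc m) = 0"
      by (simp add: G_def Rb sgn_div_norm)
    moreover have "G x \<in> ?S"
      using GS equator x by blast
    ultimately show "G x \<in> flat_sphere m"
      by (auto simp: flat_sphere_def intro: flat_SucD)
  qed
  have "odd (deg m G)"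
    using m Geq oddG by (intro Suc.IH continuous_on_subset[OF contG equator]) auto
  then have "odd (deg (Suc m) G)"
    using even_deg_step[OF m contG GS Geq oddG] by simp
  \<comment> \<open>An odd product has odd factors, so the degree of \<open>R\<close> never has to
    be computed.\<close>
  then have "odd (deg (Suc m) (sgn \<circ> k))"
    unfolding G_def deg_compose[OF m sgnk contR RS] by simp
  then show ?case
    by (simp only: deg1 deg2 not_False_eq_True)
qed

text \<open>Without a zero, \<open>sgn o F\<close> would be an odd self-map missing the pole
  \<open>b m\<close>: its degree would be 0 and odd at once.\<close>

lemma odd_map_flat_sphere_has_zero:
  assumes m: "m < DIM('a)" and F: "continuous_on (flat_sphere m) F" "F \<in> flat_sphere m \<rightarrow> flat m"
    and oddF: "\<And>x. x \<in> flat_sphere m \<Longrightarrow> F (- x) = - F x"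
  shows "\<exists>x\<in>flat_sphere m. F x = 0"
proof (rule ccontr)
  assume nz: "\<not> ?thesis"
  have cont: "continuous_on (flat_sphere m) (sgn \<circ> F)"
    using F(1) nz by (auto simp: o_def intro!: continuous_intros)
  have FT: "F x \<in> flat (Suc m)" if "x \<in> flat_sphere m" for x
    using F(2) that flat_mono[of m "Suc m"] by auto
  have maps: "sgn \<circ> F \<in> flat_sphere m \<rightarrow> flat_sphere m"
    using FT nz by (auto intro!: sgn_flat_sphere)
  have b: "b m \<in> flat_sphere m"
    using m by (auto simp: flat_sphere_def flat_def inner_b norm_Basis)
  have "b m \<notin> (sgn \<circ> F) ` flat_sphere m"
  proof
    assume "b m \<in> (sgn \<circ> F) ` flat_sphere m"
    then obtain x where x: "x \<in> flat_sphere m" "b m = sgn (F x)"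
      by auto
    have "F x \<bullet> b m = 0"
      using funcset_mem[OF F(2) x(1)] m by (simp add: flat_def)
    then have "b m \<bullet> b m = 0"
      by (subst x(2)) (simp add: sgn_div_norm)
    then show False
      using m by (simp add: inner_b)
  qed
  then have "deg m (sgn \<circ> F) = 0"
    by (intro deg_nonsurjective[OF m cont maps b])
  moreover have "odd (deg m (sgn \<circ> F))"
    using oddF by (intro odd_deg_odd_map[OF m cont maps]) (simp add: sgn_minus)
  ultimately show False by simp
qed

end

text \<open>The target is encoded as in \<open>odd_map_into\<close>, so the result bounds the genus
  directly. With \<open>m = DIM('a) - 1\<close>, \<open>flat_sphere m\<close> is the whole unit
  sphere.\<close>

theorem Borsuk_Ulam:
  fixes g :: "'a::euclidean_space \<Rightarrow> nat \<Rightarrow> real"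
  assumes cont: "continuous_on (sphere 0 1) g" and k: "k < DIM('a)"
    and oddg: "\<And>x. x \<in> sphere 0 1 \<Longrightarrow> g (- x) = (\<lambda>i. - g x i)"
    and supp: "\<And>x i. x \<in> sphere 0 1 \<Longrightarrow> k \<le> i \<Longrightarrow> g x i = 0"
  shows "\<exists>x\<in>sphere 0 1. g x = (\<lambda>i. 0)"
proof -
  obtain b :: "nat \<Rightarrow> 'a" where "bij_betw b {0..<DIM('a)} Basis"
    using ex_bij_betw_nat_finite[OF finite_Basis] by blast
  then interpret basis_enumeration b
    by unfold_locales (simp add: atLeast0LessThan)
  define m where "m = DIM('a) - 1"
  have m: "m < DIM('a)" "k \<le> m"
    using k by (auto simp: m_def)
  have S: "flat_sphere m = sphere 0 1"
    by (auto simp: flat_sphere_def flat_def m_def)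
  have "\<exists>x\<in>flat_sphere m. (vec_of \<circ> g) x = 0"
  proof (rule odd_map_flat_sphere_has_zero[OF m(1)])
    show "continuous_on (flat_sphere m) (vec_of \<circ> g)"
      unfolding S by (rule continuous_on_compose[OF cont continuous_on_vec_of])
    show "vec_of \<circ> g \<in> flat_sphere m \<rightarrow> flat m"
      using supp m(2) by (auto simp: S flat_def vec_of_inner)
    show "(vec_of \<circ> g) (- x) = - (vec_of \<circ> g) x" if "x \<in> flat_sphere m" for x
      using that oddg by (simp add: S vec_of_uminus)
  qed
  then obtain x where x: "x \<in> sphere 0 1" "vec_of (g x) = 0"
    by (auto simp: S)
  have "g x i = 0" for i
  proof (cases "i < DIM('a)")
    case True
    then show ?thesis
      using vec_of_inner[OF True, of "g x"] x(2) by simp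
  next
    case False
    then show ?thesis
      using supp[OF x(1)] k by simp
  qed
  with x(1) show ?thesis
    by blast
qed

section \<open>Signed powers\<close>

text \<open>The odd map usually written |x|^(r-1) x; the form with \<open>sgn\<close> avoids a
  negative exponent when \<open>r < 1\<close>.\<close>

definition spow :: "real \<Rightarrow> real \<Rightarrow> real" where
  "spow r x = sgn x * \<bar>x\<bar> powr r"

lemma abs_spow: "\<bar>spow r x\<bar> = \<bar>x\<bar> powr r"
  by (cases "x = 0") (auto simp: spow_def abs_mult abs_sgn_eq)

lemma spow_minus: "spow r (- x) = - spow r x"
  by (simp add: spow_def sgn_minus)

lemma spow_nonneg: "x \<ge> 0 \<Longrightarrow> spow r x = x powr r"
  by (cases "x = 0") (auto simp: spow_def)

lemma spow_sign: "c = 1 \<or> c = -1 \<Longrightarrow> spow r (c * x) = c * spow r x"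
  by (auto simp: spow_minus)

lemma continuous_on_spow:
  assumes "r > 0" "continuous_on X f"
  shows "continuous_on X (\<lambda>x. spow r (f x))"
proof -
  \<comment> \<open>Splitting into positive and negative parts leaves powers with nonnegative base;
    the inactive part contributes \<open>0 powr r = 0\<close>.\<close>
  have eq: "spow r y = max y 0 powr r - max (- y) 0 powr r" for y
    by (auto simp: spow_def max_def sgn_if)
  show ?thesis
    unfolding eq using assms
    by (intro continuous_on_diff continuous_on_powr' continuous_on_max continuous_on_minus
        continuous_on_const) auto
qed

lemma DERIV_spow:
  assumes "s > 1"
  shows "(spow s has_real_derivative s * \<bar>x\<bar> powr (s - 1)) (at x)"
proof -
  consider "x > 0" | "x < 0" | "x = 0" by linarith
  then show ?thesis
  proof cases
    case 1
    have "((\<lambda>y. y powr s) has_real_derivative s * \<bar>x\<bar> powr (s - 1)) (at x)"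
      using 1 by (auto intro!: derivative_eq_intros)
    then show ?thesis
    proof (rule has_field_derivative_transform_within_open)
      show "x \<in> {0<..}" using 1 by simp
    qed (auto simp: spow_def)
  next
    case 2
    have "((\<lambda>y. - ((- y) powr s)) has_real_derivative s * \<bar>x\<bar> powr (s - 1)) (at x)"
      using 2 by (auto intro!: derivative_eq_intros)
    then show ?thesis
    proof (rule has_field_derivative_transform_within_open)
      show "x \<in> {..<0}" using 2 by simp
    qed (auto simp: spow_def)
  next
    case 3
    \<comment> \<open>At 0 the difference quotient is exactly
      \<open>\<bar>h\<bar> powr (s - 1)\<close>, which tends to 0 because
      \<open>s > 1\<close>.\<close>
    have "((\<lambda>h. \<bar>h\<bar> powr (s - 1)) \<longlongrightarrow> \<bar>0\<bar> powr (s - 1)) (at (0::real))"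
      using assms by (intro tendsto_powr' tendsto_intros) auto
    moreover have "eventually (\<lambda>h. \<bar>h\<bar> powr (s - 1) = (spow s (0 + h) - spow s 0) / h) (at 0)"
    proof -
      have "\<bar>h\<bar> powr (s - 1) = (spow s (0 + h) - spow s 0) / h" if "h \<noteq> 0" for h
        using that by (cases "h > 0") (auto simp: spow_def powr_diff field_simps)
      then show ?thesis
        by (auto simp: eventually_at_filter)
    qed
    ultimately have "((\<lambda>h. (spow s (0 + h) - spow s 0) / h) \<longlongrightarrow> 0) (at 0)"
      by (rule Lim_transform_eventually[THEN tendsto_eq_rhs]) simp
    then show ?thesis
      using 3 assms by (simp add: DERIV_def)
  qed
qed

section \<open>Tangent and chord inequalities, and increments of signed powers\<close>

lemma powr_le_tangent:
  fixes x M t :: real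
  assumes "0 \<le> x" "0 < M" "0 \<le> t" "t \<le> 1"
  shows "x powr t \<le> M powr t * (1 + t * (x / M - 1))"
proof (cases "x = 0")
  case True
  then show ?thesis using assms by simp
next
  case False
  \<comment> \<open>Weighted arithmetic-geometric mean of \<open>x / M\<close> and 1.\<close>
  then have "(x / M) powr t * 1 powr (1 - t) \<le> t * (x / M) + (1 - t) * 1"
    using assms by (intro Youngs_inequality_0) auto
  then have "(x / M) powr t \<le> 1 + t * (x / M - 1)"
    by (simp add: algebra_simps)
  then have "M powr t * (x / M) powr t \<le> M powr t * (1 + t * (x / M - 1))"
    by (intro mult_left_mono) auto
  then show ?thesis
    using assms by (simp add: powr_mult[symmetric])
qed

text \<open>The concave tangent bound for the inverse power \<open>1/q\<close>, taken at
  \<open>M powr q\<close> and solved for \<open>x powr q\<close>.\<close>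

lemma powr_ge_tangent:
  fixes x M q :: real
  assumes "0 \<le> x" "0 < M" "1 \<le> q"
  shows "M powr q * (1 + q * (x / M - 1)) \<le> x powr q"
proof -
  have "(x powr q) powr (1/q) \<le> (M powr q) powr (1/q) * (1 + (1/q) * (x powr q / M powr q - 1))"
    using assms by (intro powr_le_tangent) auto
  then have "x / M \<le> 1 + (1/q) * (x powr q / M powr q - 1)"
    using assms by (simp add: powr_powr field_simps)
  then have "1 + q * (x / M - 1) \<le> x powr q / M powr q"
    using assms by (simp add: field_simps)
  then show ?thesis
    using assms by (simp add: field_simps)
qed

text \<open>For equal signs this is subadditivity of the power \<open>r\<close> together with
  \<open>2 powr r \<le> 2\<close>. For opposite signs it is concavity, by the tangent at the mean
  \<open>M\<close> of \<open>a\<close> and \<open>- b\<close>.\<close>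

lemma spow_diff_le_aux:
  assumes r: "0 < r" "r \<le> 1" and b: "\<bar>b\<bar> \<le> a"
  shows "\<bar>spow r a - spow r b\<bar> / 2 \<le> (\<bar>a - b\<bar> / 2) powr r"
proof (cases "b \<ge> 0")
  case True
  show ?thesis
  proof (cases "a = 0")
    case False
    have a: "a > 0" "b \<le> a" using b False True by auto
    have lin: "x / a * a powr r \<le> x powr r" if "0 \<le> x" "x \<le> a" for x
    proof -
      have "(x / a) powr 1 \<le> (x / a) powr r"
        using that a r by (intro powr_mono') auto
      then have "x / a \<le> x powr r / a powr r"
        using that a by (simp add: powr_divide)
      then show ?thesis
        using a by (simp add: field_simps)
    qed
    have "a powr r = (b / a + (a - b) / a) * a powr r"
      using a by (simp add: field_simps)
    also have "\<dots> \<le> b powr r + (a - b) powr r"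
      using lin[of b] lin[of "a - b"] True a by (simp add: distrib_right)
    finally have 1: "a powr r - b powr r \<le> (a - b) powr r" by simp
    have "(2::real) powr r \<le> 2 powr 1"
      using r by (intro powr_mono) auto
    then have "(a - b) powr r * 2 powr r \<le> (a - b) powr r * 2"
      by (intro mult_left_mono) auto
    then have "(a - b) powr r / 2 \<le> ((a - b) / 2) powr r"
      using a by (simp add: powr_divide field_simps)
    moreover have "b powr r \<le> a powr r"
      using a True r by (intro powr_mono2) auto
    ultimately show ?thesis
      using 1 a True by (simp add: spow_nonneg)
  qed (use b in auto)
next
  case False
  define M where "M = (a - b) / 2"
  have M: "M > 0" using b False by (auto simp: M_def)
  have "a powr r + (- b) powr r \<le> M powr r * (1 + r * (a / M - 1)) + M powr r * (1 + r * ((-b) / M - 1))"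
    using M b False r by (intro add_mono powr_le_tangent) auto
  also have "\<dots> = M powr r * (2 + r * ((a - b) / M - 2))"
    by (simp add: algebra_simps diff_divide_distrib)
  also have "(a - b) / M = 2"
  proof -
    have "a - b = 2 * M"
      by (simp add: M_def)
    then show ?thesis
      using M by simp
  qed
  finally have "a powr r + (- b) powr r \<le> 2 * M powr r" by simp
  moreover have "\<bar>spow r a - spow r b\<bar> = a powr r + (- b) powr r"
    using b False spow_minus[of r "- b"] by (simp add: spow_nonneg)
  moreover have "\<bar>a - b\<bar> / 2 = M"
    using M by (simp add: M_def)
  ultimately show ?thesis by simp
qed

lemma spow_diff_le:
  assumes r: "0 < r" "r \<le> 1"
  shows "\<bar>spow r a - spow r b\<bar> / 2 \<le> (\<bar>a - b\<bar> / 2) powr r"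
proof -
  consider "\<bar>b\<bar> \<le> a" | "\<bar>b\<bar> \<le> - a" | "\<bar>a\<bar> \<le> b" | "\<bar>a\<bar> \<le> - b" by linarith
  then show ?thesis
  proof cases
    case 1
    then show ?thesis by (rule spow_diff_le_aux[OF r])
  next
    case 2
    then show ?thesis
      using spow_diff_le_aux[OF r, of "-b" "-a"] by (simp add: spow_minus abs_minus_commute)
  next
    case 3
    then show ?thesis
      using spow_diff_le_aux[OF r, of a b] by (simp add: abs_minus_commute)
  next
    case 4
    then show ?thesis
      using spow_diff_le_aux[OF r, of "-a" "-b"] by (simp add: spow_minus abs_minus_commute)
  qed
qed

text \<open>Convexity of \<open>\<bar>x\<bar> powr q\<close>: the tangent bound at
  \<open>\<bar>x\<bar>\<close> is applied to \<open>\<bar>a\<bar>\<close> and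
  \<open>\<bar>b\<bar>\<close> and averaged. The tangent point must be positive, so
  \<open>x = 0\<close> is separate.\<close>

lemma abs_powr_le_chord:
  fixes a b x q :: real
  assumes "b < a" "b \<le> x" "x \<le> a" "1 \<le> q"
  shows "\<bar>x\<bar> powr q \<le> ((x - b) * \<bar>a\<bar> powr q + (a - x) * \<bar>b\<bar> powr q) / (a - b)"
proof (cases "x = 0")
  case True
  then have "0 \<le> ((x - b) * \<bar>a\<bar> powr q + (a - x) * \<bar>b\<bar> powr q) / (a - b)"
    using assms by (intro divide_nonneg_nonneg add_nonneg_nonneg mult_nonneg_nonneg) auto
  then show ?thesis using True by simp
next
  case False
  let ?M = "\<bar>x\<bar>"
  have tan: "?M powr q * (1 + q * (y / ?M - 1)) \<le> y powr q" if "y \<ge> 0" for y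
    using that False assms by (intro powr_ge_tangent) auto
  have "(a - b) * x = (x - b) * a + (a - x) * b"
    by (simp add: algebra_simps)
  then have "(a - b) * \<bar>x\<bar> = \<bar>(x - b) * a + (a - x) * b\<bar>"
    using assms by (metis abs_mult abs_of_pos diff_gt_0_iff_gt)
  also have "\<dots> \<le> (x - b) * \<bar>a\<bar> + (a - x) * \<bar>b\<bar>"
    using assms by (intro order_trans[OF abs_triangle_ineq]) (simp add: abs_mult)
  finally have le: "(a - b) * ?M \<le> (x - b) * \<bar>a\<bar> + (a - x) * \<bar>b\<bar>" .
  have "0 \<le> q * (((x - b) * \<bar>a\<bar> + (a - x) * \<bar>b\<bar>) / ?M - (a - b))"
  proof (rule mult_nonneg_nonneg)
    show "0 \<le> ((x - b) * \<bar>a\<bar> + (a - x) * \<bar>b\<bar>) / ?M - (a - b)"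
      using le False by (simp add: field_simps)
  qed (use assms in simp)
  then have "(a - b) * ?M powr q
      \<le> ?M powr q * ((a - b) + q * (((x - b) * \<bar>a\<bar> + (a - x) * \<bar>b\<bar>) / ?M - (a - b)))"
    by (simp add: distrib_left mult.commute)
  also have "\<dots> = (x - b) * (?M powr q * (1 + q * (\<bar>a\<bar> / ?M - 1)))
      + (a - x) * (?M powr q * (1 + q * (\<bar>b\<bar> / ?M - 1)))"
    by (simp add: divide_inverse algebra_simps)
  also have "\<dots> \<le> (x - b) * \<bar>a\<bar> powr q + (a - x) * \<bar>b\<bar> powr q"
    using assms by (intro add_mono mult_left_mono tan) auto
  finally show ?thesis
    using assms by (simp add: field_simps)
qed

text \<open>The exponent \<open>t = 1/p - 1/q\<close> satisfies \<open>q * t = q/p - 1\<close>, so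
  the derivative of \<open>spow (q/p)\<close> is \<open>q/p\<close> times the \<open>t\<close>-th
  power of \<open>\<bar>x\<bar> powr q\<close>, and Jensen's inequality for the concave power
  \<open>t\<close> applies.\<close>

lemma spow_diff_le_mean_aux:
  assumes pq: "1 < p" "p < q" and ab: "b < a"
  shows "\<bar>spow (q/p) a - spow (q/p) b\<bar>
      \<le> (q/p) * \<bar>a - b\<bar> * ((\<bar>a\<bar> powr q + \<bar>b\<bar> powr q) / 2) powr (1/p - 1/q)"
proof -
  define s t A B N where "s = q / p" and "t = 1/p - 1/q"
    and "A = \<bar>a\<bar> powr q" and "B = \<bar>b\<bar> powr q" and "N = (A + B) / 2"
  have s: "s > 1" using pq by (simp add: s_def)
  have "1 / p \<le> 1" "0 \<le> 1 / q" "1 / q \<le> 1 / p" "q * t = s - 1"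
    using pq by (auto simp: t_def s_def field_simps)
  then have t: "0 \<le> t" "t \<le> 1" "q * t = s - 1"
    unfolding t_def by linarith+
  have N: "N > 0"
  proof -
    have "a \<noteq> 0 \<or> b \<noteq> 0" using ab by auto
    then have "A > 0 \<or> B > 0" by (auto simp: A_def B_def)
    moreover have "A \<ge> 0" "B \<ge> 0" by (auto simp: A_def B_def)
    ultimately show ?thesis by (auto simp: N_def)
  qed
  \<comment> \<open>\<^term>\<open>L\<close> is the chord of \<open>\<bar>x\<bar> powr q\<close> over \<open>[b, a]\<close> and \<^term>\<open>P\<close> its primitive; the mean of the
    chord is \<^term>\<open>N\<close>, so the tangent of \<open>y powr t\<close> at \<^term>\<open>N\<close> bounds the integral of the derivative.\<close>
  define P where "P = (\<lambda>x. ((x - b)^2 * A + ((a - b)^2 - (a - x)^2) * B) / (2 * (a - b)))"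
  define L where "L = (\<lambda>x. ((x - b) * A + (a - x) * B) / (a - b))"
  \<comment> \<open>A primitive of the tangent bound minus \<open>spow s\<close>; its monotonicity
    replaces integrating the pointwise estimate.\<close>
  define \<Phi> where "\<Phi> = (\<lambda>x. s * N powr t * ((x - b) + t * (P x / N - (x - b))) - spow s x)"
  have dP: "(P has_real_derivative L x) (at x)" for x
  proof -
    have "(P has_real_derivative (2 * (x - b) * A + 2 * (a - x) * B) / (2 * (a - b))) (at x)"
      unfolding P_def by (intro DERIV_cdivide) (auto intro!: derivative_eq_intros)
    also have "(2 * (x - b) * A + 2 * (a - x) * B) / (2 * (a - b)) = L x"
      using ab by (simp add: L_def divide_simps) (simp add: algebra_simps)
    finally show ?thesis .
  qed
  have d\<Phi>: "(\<Phi> has_real_derivative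
      s * N powr t * (1 + t * (L x / N - 1)) - s * \<bar>x\<bar> powr (s - 1)) (at x)" for x
    unfolding \<Phi>_def using s N
    by (auto intro!: derivative_eq_intros dP DERIV_spow)
  have "\<Phi> b \<le> \<Phi> a"
  proof (rule DERIV_nonneg_imp_nondecreasing[where f = \<Phi>])
    fix x assume x: "b \<le> x" "x \<le> a"
    have "\<bar>x\<bar> powr q \<le> L x"
      unfolding L_def A_def B_def using x ab pq by (intro abs_powr_le_chord) auto
    then have "(\<bar>x\<bar> powr q) powr t \<le> L x powr t"
      using t by (intro powr_mono2) auto
    also have "\<dots> \<le> N powr t * (1 + t * (L x / N - 1))"
    proof (rule powr_le_tangent)
      show "0 \<le> L x"
        using \<open>\<bar>x\<bar> powr q \<le> L x\<close> powr_ge_zero[of "\<bar>x\<bar>" q] by linarith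
    qed (use N t in auto)
    finally have "\<bar>x\<bar> powr (s - 1) \<le> N powr t * (1 + t * (L x / N - 1))"
      by (simp add: powr_powr t)
    then have "s * \<bar>x\<bar> powr (s - 1) \<le> s * (N powr t * (1 + t * (L x / N - 1)))"
      using s by (intro mult_left_mono) auto
    then show "\<exists>y. (\<Phi> has_real_derivative y) (at x) \<and> 0 \<le> y"
      using d\<Phi>[of x] by (intro exI conjI) auto
  qed (use ab in simp)
  \<comment> \<open>Hence the correction term with factor \<open>t\<close> in \<open>\<Phi>\<close>
    vanishes at both endpoints.\<close>
  moreover have "P a = (a - b) * N" "P b = 0"
    using ab by (auto simp: P_def N_def power2_eq_square field_simps)
  moreover from this have "P a / N = a - b"
    using N by simp
  ultimately have "spow s a - spow s b \<le> s * (a - b) * N powr t"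
    by (simp only: \<Phi>_def) (simp add: mult_ac)
  moreover have "spow s b \<le> spow s a"
  proof (rule DERIV_nonneg_imp_nondecreasing[where f = "spow s"])
    show "\<exists>y. (spow s has_real_derivative y) (at x) \<and> 0 \<le> y" for x
      using DERIV_spow[OF s, of x] s by (intro exI conjI) auto
  qed (use ab in simp)
  ultimately show ?thesis
    using ab by (simp add: s_def t_def N_def A_def B_def)
qed

lemma spow_diff_le_mean:
  assumes "1 < p" "p < q"
  shows "\<bar>spow (q/p) a - spow (q/p) b\<bar>
      \<le> (q/p) * \<bar>a - b\<bar> * ((\<bar>a\<bar> powr q + \<bar>b\<bar> powr q) / 2) powr (1/p - 1/q)"
proof -
  consider "b < a" | "a < b" | "a = b" by linarith
  then show ?thesis
  proof cases
    case 1
    then show ?thesis by (rule spow_diff_le_mean_aux[OF assms])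
  next
    case 2
    then show ?thesis
      using spow_diff_le_mean_aux[OF assms, of a b]
      by (simp only: abs_minus_commute[of a] abs_minus_commute[of "spow (q/p) a"] add.commute[of "\<bar>a\<bar> powr q"])
  qed simp
qed

text \<open>Young's inequality for the normalized terms \<open>x i / X\<close> and
  \<open>y i / Y\<close>, summed with weights. If \<open>X\<close> or \<open>Y\<close> is 0, every
  term on the left vanishes.\<close>

lemma sum_Holder_powr:
  fixes W x y :: "'i \<Rightarrow> real"
  assumes W: "\<And>i. i \<in> I \<Longrightarrow> 0 \<le> W i" and x: "\<And>i. i \<in> I \<Longrightarrow> 0 \<le> x i"
    and y: "\<And>i. i \<in> I \<Longrightarrow> 0 \<le> y i" and t: "0 < t" "t < 1" and fin: "finite I"
  shows "(\<Sum>i\<in>I. W i * (x i powr t * y i powr (1 - t)))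
      \<le> (\<Sum>i\<in>I. W i * x i) powr t * (\<Sum>i\<in>I. W i * y i) powr (1 - t)"
proof -
  define X Y where "X = (\<Sum>i\<in>I. W i * x i)" and "Y = (\<Sum>i\<in>I. W i * y i)"
  have XY: "X \<ge> 0" "Y \<ge> 0"
    unfolding X_def Y_def using W x y by (auto intro!: sum_nonneg)
  show ?thesis
  proof (cases "X = 0 \<or> Y = 0")
    case True
    then have "\<forall>i\<in>I. W i * x i = 0 \<or> W i * y i = 0"
      unfolding X_def Y_def using W x y fin by (auto simp: sum_nonneg_eq_0_iff)
    then have "(\<Sum>i\<in>I. W i * (x i powr t * y i powr (1 - t))) = 0"
      by (intro sum.neutral) auto
    then show ?thesis by simp
  next
    case False
    then have pos: "X > 0" "Y > 0" using XY by auto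
    have "x i powr t * y i powr (1 - t) \<le> X powr t * Y powr (1 - t) * (t * (x i / X) + (1 - t) * (y i / Y))"
      if i: "i \<in> I" for i
    proof (cases "x i = 0 \<or> y i = 0")
      case True
      then show ?thesis
        using x[OF i] y[OF i] pos t by auto
    next
      case False
      then have "(x i / X) powr t * (y i / Y) powr (1 - t) \<le> t * (x i / X) + (1 - t) * (y i / Y)"
        using x[OF i] y[OF i] pos t by (intro Youngs_inequality_0) auto
      then have "X powr t * Y powr (1 - t) * ((x i / X) powr t * (y i / Y) powr (1 - t))
          \<le> X powr t * Y powr (1 - t) * (t * (x i / X) + (1 - t) * (y i / Y))"
        by (intro mult_left_mono) auto
      then show ?thesis
        using x[OF i] y[OF i] pos by (simp add: powr_divide)
    qed
    then have "(\<Sum>i\<in>I. W i * (x i powr t * y i powr (1 - t)))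
        \<le> (\<Sum>i\<in>I. W i * (X powr t * Y powr (1 - t) * (t * (x i / X) + (1 - t) * (y i / Y))))"
      using W by (intro sum_mono mult_left_mono) auto
    also have "\<dots> = X powr t * Y powr (1 - t) * (t * (X / X) + (1 - t) * (Y / Y))"
      unfolding X_def Y_def sum_divide_distrib sum_distrib_left sum.distrib[symmetric]
      by (intro sum.cong refl) (simp add: algebra_simps)
    also have "\<dots> = X powr t * Y powr (1 - t)"
      using pos by simp
    finally show ?thesis
      unfolding X_def Y_def .
  qed
qed

section \<open>Genus and variational eigenvalues\<close>

text \<open>Removes the least element and the infinite case, so that genus bounds become statements
  about pulling back odd maps.\<close>

lemma enat_le_genus_iff: "enat k \<le> genus B \<longleftrightarrow> (\<forall>m<k. \<not> odd_map_into B m)"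
proof (cases "\<exists>m. odd_map_into B m")
  case True
  then have "odd_map_into B (LEAST m. odd_map_into B m)"
    by (rule LeastI_ex)
  then have "k \<le> (LEAST m. odd_map_into B m) \<longleftrightarrow> (\<forall>m<k. \<not> odd_map_into B m)"
    by (meson Least_le not_le order.strict_trans2)
  then show ?thesis
    using True by (simp add: genus_def)
qed (auto simp: genus_def)

text \<open>Composing with \<open>\<phi>\<close> pulls odd maps back, so the image under an odd
  continuous map has genus at least that of \<open>B\<close>.\<close>

lemma odd_map_into_image:
  fixes \<phi> :: "real^'m::finite \<Rightarrow> real^'n::finite"
  assumes "odd_map_into (\<phi> ` B) m" "continuous_on B \<phi>" "\<And>x. \<phi> (- x) = - \<phi> x"
  shows "odd_map_into B m"
proof -
  from assms(1) obtain g :: "real^'n \<Rightarrow> nat \<Rightarrow> real" where "continuous_on (\<phi> ` B) g"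
    and g: "\<And>y. y \<in> \<phi> ` B \<Longrightarrow> g (- y) = (\<lambda>i. - g y i) \<and> g y \<noteq> (\<lambda>i. 0) \<and> (\<forall>i\<ge>m. g y i = 0)"
    unfolding odd_map_into_def by blast
  then have "continuous_on B (g \<circ> \<phi>)"
    using assms(2) by (intro continuous_on_compose)
  moreover have "(g \<circ> \<phi>) (- x) = (\<lambda>i. - (g \<circ> \<phi>) x i) \<and> (g \<circ> \<phi>) x \<noteq> (\<lambda>i. 0) \<and> (\<forall>i\<ge>m. (g \<circ> \<phi>) x i = 0)"
    if "x \<in> B" for x
    using g[of "\<phi> x"] that assms(3)[of x] by simp
  ultimately show ?thesis
    unfolding odd_map_into_def by blast
qed

lemma odd_map_into_subset:
  fixes B :: "(real^'n::finite) set"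
  assumes "odd_map_into B m" "A \<subseteq> B"
  shows "odd_map_into A m"
proof -
  obtain g :: "real^'n \<Rightarrow> nat \<Rightarrow> real" where "continuous_on B g"
    and "\<forall>x\<in>B. g (- x) = (\<lambda>i. - g x i) \<and> g x \<noteq> (\<lambda>i. 0) \<and> (\<forall>i\<ge>m. g x i = 0)"
    using assms(1) unfolding odd_map_into_def by blast
  then show ?thesis
    unfolding odd_map_into_def using assms(2)
    by (intro exI[of _ g] conjI continuous_on_subset[of B g A]) auto
qed

lemma continuous_on_abs_powr:
  fixes f :: "'a::topological_space \<Rightarrow> real"
  assumes "0 < p" "continuous_on X f"
  shows "continuous_on X (\<lambda>x. \<bar>f x\<bar> powr p)"
  using assms by (intro continuous_on_powr' continuous_on_rabs continuous_on_const) auto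

lemma compact_p_sphere:
  fixes mu :: "'n::finite \<Rightarrow> real"
  assumes mu: "\<And>i. mu i > 0" and p: "0 < p"
  shows "compact (p_sphere mu p)"
proof (rule compact_eq_bounded_closed[THEN iffD2], intro conjI)
  show "closed (p_sphere mu p)"
    unfolding p_sphere_def using p
    by (intro closed_Collect_eq continuous_on_sum continuous_on_mult continuous_on_const
        continuous_on_abs_powr continuous_on_component continuous_on_id)
  show "bounded (p_sphere mu p)"
  proof (rule boundedI)
    fix f :: "real^'n" assume "f \<in> p_sphere mu p"
    then have sum: "(\<Sum>i\<in>UNIV. mu i * \<bar>f$i\<bar> powr p) = 1"
      by (simp add: p_sphere_def)
    have "\<bar>f$i\<bar> \<le> (1 / mu i) powr (1/p)" for i
    proof -
      have "mu i * \<bar>f$i\<bar> powr p \<le> (\<Sum>i\<in>UNIV. mu i * \<bar>f$i\<bar> powr p)"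
        using mu by (intro member_le_sum) (auto simp: less_imp_le)
      then have "\<bar>f$i\<bar> powr p \<le> 1 / mu i"
        using mu[of i] by (simp add: sum field_simps)
      then have "(\<bar>f$i\<bar> powr p) powr (1/p) \<le> (1 / mu i) powr (1/p)"
        using p by (intro powr_mono2) auto
      then show ?thesis
        using p by (simp add: powr_powr)
    qed
    then have "(\<Sum>i\<in>UNIV. \<bar>f$i\<bar>) \<le> (\<Sum>i\<in>UNIV. (1 / mu i) powr (1/p))"
      by (intro sum_mono)
    then show "norm f \<le> (\<Sum>i\<in>UNIV. (1 / mu i) powr (1/p))"
      using norm_le_l1_cart[of f] by linarith
  qed
qed

text \<open>Here Borsuk-Ulam enters: an odd map on the \<open>p\<close>-sphere into dimension
  \<open>m < n\<close>, pulled back to the Euclidean sphere by radial projection, would have no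
  zero.\<close>

lemma p_sphere_in_genus_family:
  fixes mu :: "'n::finite \<Rightarrow> real"
  assumes mu: "\<And>i. mu i > 0" and p: "0 < p" and k: "k \<le> CARD('n)"
  shows "p_sphere mu p \<in> genus_family mu p k"
  unfolding genus_family_def
proof (intro CollectI conjI)
  show "closed (p_sphere mu p)"
    using compact_p_sphere[of mu, OF mu p] by (rule compact_imp_closed)
  have neg: "- f \<in> p_sphere mu p" if "f \<in> p_sphere mu p" for f
    using that by (simp add: p_sphere_def)
  then show "uminus ` p_sphere mu p = p_sphere mu p"
    by (force intro: image_eqI[where x = "- f" for f])
  show "enat k \<le> genus (p_sphere mu p)"
    unfolding enat_le_genus_iff
  proof (intro allI impI notI)
    fix m assume m: "m < k" and odd: "odd_map_into (p_sphere mu p) m"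
    define E where "E = (\<lambda>f::real^'n. \<Sum>i\<in>UNIV. mu i * \<bar>f$i\<bar> powr p)"
    \<comment> \<open>\<open>E\<close> is homogeneous of degree \<open>p\<close>, so this factor
      rescales \<open>f\<close> to \<open>E = 1\<close>.\<close>
    define \<rho> where "\<rho> = (\<lambda>f::real^'n. (E f powr (- 1/p)) *\<^sub>R f)"
    have E: "E f > 0" if "f \<in> sphere 0 1" for f
    proof -
      have "f \<noteq> 0" using that by auto
      then obtain i where "f$i \<noteq> 0"
        by (auto simp: vec_eq_iff)
      then have "0 < mu i * \<bar>f$i\<bar> powr p"
        using mu[of i] by simp
      also have "\<dots> \<le> E f"
        unfolding E_def using mu by (intro member_le_sum) (auto simp: less_imp_le)
      finally show ?thesis .
    qed
    have maps: "\<rho> f \<in> p_sphere mu p" if f: "f \<in> sphere 0 1" for f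
    proof -
      have "(\<Sum>i\<in>UNIV. mu i * \<bar>\<rho> f $ i\<bar> powr p) = (\<Sum>i\<in>UNIV. (E f powr (- 1/p)) powr p * (mu i * \<bar>f$i\<bar> powr p))"
        by (intro sum.cong refl) (simp add: \<rho>_def abs_mult powr_mult)
      also have "\<dots> = (E f powr (- 1/p)) powr p * E f"
        by (simp add: E_def sum_distrib_left)
      also have "(E f powr (- 1/p)) powr p = E f powr - 1"
        using p by (subst powr_powr) simp
      also have "E f powr - 1 * E f = 1"
        using E[OF f] by (simp add: powr_minus)
      finally show ?thesis by (simp add: p_sphere_def)
    qed
    have cont: "continuous_on (sphere 0 1) \<rho>"
    proof -
      have "continuous_on (sphere 0 1) E"
        unfolding E_def using p
        by (intro continuous_on_sum continuous_on_mult continuous_on_const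
            continuous_on_abs_powr continuous_on_component continuous_on_id)
      then show ?thesis
        unfolding \<rho>_def using E
        by (intro continuous_on_scaleR continuous_on_powr continuous_on_const continuous_on_id) force+
    qed
    have neg\<rho>: "\<rho> (- f) = - \<rho> f" for f
      by (simp add: \<rho>_def E_def)
    have "odd_map_into (\<rho> ` sphere 0 1) m"
      using maps by (intro odd_map_into_subset[OF odd]) auto
    then have "odd_map_into (sphere 0 1 :: (real^'n) set) m"
      using cont neg\<rho> by (rule odd_map_into_image)
    then obtain g :: "real^'n \<Rightarrow> nat \<Rightarrow> real" where "continuous_on (sphere 0 1) g"
      and g: "\<And>x. x \<in> sphere 0 1 \<Longrightarrow> g (- x) = (\<lambda>i. - g x i) \<and> g x \<noteq> (\<lambda>i. 0) \<and> (\<forall>i\<ge>m. g x i = 0)"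
      unfolding odd_map_into_def by blast
    moreover have "m < DIM(real^'n)"
      using m k by simp
    ultimately have "\<exists>x\<in>sphere 0 1. g x = (\<lambda>i. 0)"
      by (intro Borsuk_Ulam[where k = m]) auto
    then show False
      using g by blast
  qed
qed simp

section \<open>Signed powers carry genus families to genus families\<close>

definition spow_vec :: "real \<Rightarrow> real^'n \<Rightarrow> real^'n" where
  "spow_vec r f = (\<chi> i. spow r (f$i))"

lemma spow_vec_nth [simp]: "spow_vec r f $ i = spow r (f$i)"
  by (simp add: spow_vec_def)

lemma spow_vec_minus: "spow_vec r (- f) = - spow_vec r f"
  by (simp add: vec_eq_iff spow_minus)

lemma continuous_on_spow_vec:
  fixes X :: "(real^'n::finite) set"
  assumes "0 < r"
  shows "continuous_on X (spow_vec r)"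
  unfolding spow_vec_def using assms
  by (intro continuous_on_vec_lambda continuous_on_spow continuous_on_component continuous_on_id)

lemma spow_vec_in_p_sphere:
  assumes "0 < p" "0 < q" "f \<in> p_sphere mu p"
  shows "spow_vec (p / q) f \<in> p_sphere mu q"
  using assms by (simp add: p_sphere_def abs_spow powr_powr)

text \<open>Closedness of the image comes from compactness of \<open>B\<close>. The exponents are
  not ordered, so both directions between the spheres are covered.\<close>

lemma spow_vec_image_genus_family:
  fixes mu :: "'n::finite \<Rightarrow> real"
  assumes mu: "\<And>i. mu i > 0" and pq: "0 < p" "0 < q" and B: "B \<in> genus_family mu p k"
  shows "spow_vec (p / q) ` B \<in> genus_family mu q k"
proof -
  have sub: "B \<subseteq> p_sphere mu p" and "closed B" and sym: "uminus ` B = B" and gen: "enat k \<le> genus B"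
    using B by (auto simp: genus_family_def)
  have "compact B"
    using \<open>closed B\<close> sub compact_p_sphere[of mu, OF mu pq(1)]
    by (metis closed_Int_compact inf.absorb1)
  have cont: "continuous_on B (spow_vec (p / q))"
    using pq by (intro continuous_on_spow_vec) simp
  have "closed (spow_vec (p / q) ` B)"
    using \<open>compact B\<close> cont by (intro compact_imp_closed compact_continuous_image)
  moreover have "uminus ` spow_vec (p / q) ` B = spow_vec (p / q) ` uminus ` B"
    by (simp add: image_image spow_vec_minus)
  moreover have "enat k \<le> genus (spow_vec (p / q) ` B)"
    using gen odd_map_into_image[OF _ cont spow_vec_minus] unfolding enat_le_genus_iff by blast
  ultimately show ?thesis
    using sub pq by (auto simp: genus_family_def sym spow_vec_in_p_sphere)
qed

locale potential_signed_graph =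
  fixes adj :: "'n::finite \<Rightarrow> 'n \<Rightarrow> bool" and sig w :: "'n \<Rightarrow> 'n \<Rightarrow> real" and mu kappa :: "'n \<Rightarrow> real"
  assumes graph: "signed_graph adj sig w mu" and kappa: "kappa i \<ge> 0"
begin

abbreviation ray :: "real \<Rightarrow> real^'n \<Rightarrow> real" where
  "ray \<equiv> rayleigh adj sig w mu kappa"

abbreviation eig :: "real \<Rightarrow> nat \<Rightarrow> real" where
  "eig \<equiv> var_eig adj sig w mu kappa"

abbreviation D :: real where
  "D \<equiv> degD adj w mu kappa"

text \<open>The energy is written as one weighted sum: ordered pairs \<open>Inl (i, j)\<close> carry half the edge weight
  and vertices \<open>Inr i\<close> carry the potential.\<close>

definition weight :: "'n \<times> 'n + 'n \<Rightarrow> real" where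
  "weight = case_sum (\<lambda>(i, j). if adj i j then w i j / 2 else 0) kappa"

definition grad :: "real^'n \<Rightarrow> 'n \<times> 'n + 'n \<Rightarrow> real" where
  "grad f = case_sum (\<lambda>(i, j). f$i - sig i j * f$j) (\<lambda>i. f$i)"

lemma mu_pos: "mu i > 0"
  using graph by (simp add: signed_graph_def)

lemma weight_nonneg: "weight e \<ge> 0"
  using graph kappa by (auto simp: weight_def signed_graph_def less_imp_le split: sum.split)

lemma sum_weight:
  "(\<Sum>e\<in>UNIV. weight e * h e)
    = (\<Sum>i\<in>UNIV. \<Sum>j | adj i j. w i j * h (Inl (i, j))) / 2 + (\<Sum>i\<in>UNIV. kappa i * h (Inr i))"
proof -
  have "(\<Sum>e\<in>UNIV. weight e * h e)
      = (\<Sum>e\<in>UNIV \<times> UNIV. weight (Inl e) * h (Inl e)) + (\<Sum>i\<in>UNIV. weight (Inr i) * h (Inr i))"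
    by (simp add: sum.Plus flip: UNIV_Plus_UNIV)
  also have "(\<Sum>e\<in>UNIV \<times> UNIV. weight (Inl e) * h (Inl e))
      = (\<Sum>i\<in>UNIV. \<Sum>j\<in>UNIV. weight (Inl (i, j)) * h (Inl (i, j)))"
    by (simp add: sum.cartesian_product split_def)
  also have "\<dots> = (\<Sum>i\<in>UNIV. \<Sum>j | adj i j. w i j * h (Inl (i, j))) / 2"
    unfolding sum_divide_distrib
  proof (rule sum.cong[OF refl])
    fix i
    have "(\<Sum>j | adj i j. w i j * h (Inl (i, j)) / 2)
        = (\<Sum>j\<in>UNIV. if adj i j then w i j * h (Inl (i, j)) / 2 else 0)"
      using sum.inter_filter[of UNIV _ "adj i"] by simp
    also have "\<dots> = (\<Sum>j\<in>UNIV. weight (Inl (i, j)) * h (Inl (i, j)))"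
      by (intro sum.cong) (auto simp: weight_def)
    finally show "(\<Sum>j\<in>UNIV. weight (Inl (i, j)) * h (Inl (i, j)))
        = (\<Sum>j | adj i j. w i j * h (Inl (i, j)) / 2)" by simp
  qed
  finally show ?thesis
    by (simp add: weight_def)
qed

section \<open>Rayleigh quotients on the sphere and the min-max values\<close>

lemma ray_on_p_sphere:
  assumes "f \<in> p_sphere mu p"
  shows "ray p f = (\<Sum>e\<in>UNIV. weight e * \<bar>grad f e\<bar> powr p)"
  using assms unfolding sum_weight by (simp add: rayleigh_def p_sphere_def grad_def)

lemma ray_nonneg:
  assumes "f \<in> p_sphere mu p"
  shows "0 \<le> ray p f"
  unfolding ray_on_p_sphere[OF assms] by (intro sum_nonneg mult_nonneg_nonneg weight_nonneg powr_ge_zero)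

text \<open>Needed because the real \<open>Sup\<close> of an unbounded set carries no information;
  boundedness comes from continuity on the compact sphere.\<close>

lemma bdd_above_ray:
  assumes "0 < p" "B \<subseteq> p_sphere mu p"
  shows "bdd_above (ray p ` B)"
proof -
  have "continuous_on (p_sphere mu p) (\<lambda>f. grad f e)" for e
    unfolding grad_def by (cases e) (auto intro!: continuous_intros)
  then have "continuous_on (p_sphere mu p) (\<lambda>f. \<Sum>e\<in>UNIV. weight e * \<bar>grad f e\<bar> powr p)"
    using assms by (intro continuous_on_sum continuous_on_mult continuous_on_const continuous_on_abs_powr)
  then have "continuous_on (p_sphere mu p) (ray p)"
    by (rule continuous_on_eq) (simp add: ray_on_p_sphere)
  then have "compact (ray p ` p_sphere mu p)"
    using compact_p_sphere[of mu, OF mu_pos assms(1)] by (rule compact_continuous_image)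
  then show ?thesis
    using assms(2) by (meson bdd_above_mono bounded_imp_bdd_above compact_imp_bounded image_mono)
qed

text \<open>The empty set maps vacuously into dimension 0 and so has genus 0. With
  \<open>k \<ge> 1\<close> every \<open>Sup\<close> is thus over a nonempty set.\<close>

lemma genus_family_nonempty_member:
  assumes "1 \<le> k" "B \<in> genus_family mu p k"
  shows "B \<noteq> {}"
proof
  assume "B = {}"
  then have "odd_map_into B 0"
    by (simp add: odd_map_into_def)
  moreover have "enat k \<le> genus B"
    using assms by (simp add: genus_family_def)
  ultimately show False
    using assms(1) unfolding enat_le_genus_iff by auto
qed

context
  fixes k :: nat
  assumes k: "1 \<le> k" "k \<le> CARD('n)"
begin

lemma Sup_ray_nonneg:
  assumes "0 < p" "B \<in> genus_family mu p k"
  shows "0 \<le> Sup (ray p ` B)"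
proof -
  have sub: "B \<subseteq> p_sphere mu p"
    using assms by (auto simp: genus_family_def)
  obtain f where f: "f \<in> B"
    using genus_family_nonempty_member[OF k(1) assms(2)] by blast
  then have "ray p f \<le> Sup (ray p ` B)"
    using bdd_above_ray[OF assms(1) sub] by (intro cSup_upper) auto
  then show ?thesis
    using ray_nonneg[of f p] f sub by auto
qed

lemma eig_nonneg: "0 < p \<Longrightarrow> 0 \<le> eig p k"
  unfolding var_eig_def
  using p_sphere_in_genus_family[of mu, OF mu_pos _ k(2)] Sup_ray_nonneg
  by (intro cInf_greatest) blast+

lemma eig_le:
  assumes p: "0 < p" and B: "B \<in> genus_family mu p k" and le: "\<And>f. f \<in> B \<Longrightarrow> ray p f \<le> c"
  shows "eig p k \<le> c"
proof -
  have "eig p k \<le> Sup (ray p ` B)"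
    unfolding var_eig_def
  proof (rule cInf_lower)
    show "bdd_below ((\<lambda>B. Sup (ray p ` B)) ` genus_family mu p k)"
      using Sup_ray_nonneg[OF p] by (auto intro!: bdd_belowI[where m = 0])
  qed (use B in blast)
  also have "\<dots> \<le> c"
    using le genus_family_nonempty_member[OF k(1) B] by (intro cSup_least) auto
  finally show ?thesis .
qed

lemma eig_lessE:
  assumes p: "0 < p" and less: "eig p k < t"
  obtains B where "B \<in> genus_family mu p k" "\<And>f. f \<in> B \<Longrightarrow> ray p f \<le> t"
proof -
  have "(\<lambda>B. Sup (ray p ` B)) ` genus_family mu p k \<noteq> {}"
    using p_sphere_in_genus_family[of mu, OF mu_pos p k(2)] by blast
  from cInf_lessD[OF this less[unfolded var_eig_def]]
  obtain B where B: "B \<in> genus_family mu p k" "Sup (ray p ` B) < t"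
    by blast
  have sub: "B \<subseteq> p_sphere mu p"
    using B by (auto simp: genus_family_def)
  have "ray p f \<le> t" if "f \<in> B" for f
  proof -
    have "ray p f \<le> Sup (ray p ` B)"
      using that bdd_above_ray[OF p sub] by (intro cSup_upper) auto
    then show ?thesis using B(2) by simp
  qed
  with B(1) that show thesis by blast
qed

text \<open>Signed powers turn competitors for \<open>eig p k\<close> into competitors for
  \<open>eig q k\<close>. Monotonicity of \<open>h\<close> passes the pointwise bound to each
  competitor, continuity passes it to the infimum. As \<open>p\<close> and \<open>q\<close> are not
  ordered, this serves both inequalities.\<close>

lemma eig_transfer:
  assumes pq: "0 < p" "0 < q"
    and mono: "\<And>x y. 0 \<le> x \<Longrightarrow> x \<le> y \<Longrightarrow> h x \<le> h y" and cont: "continuous_on {0..} h"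
    and le: "\<And>f. f \<in> p_sphere mu p \<Longrightarrow> ray q (spow_vec (p / q) f) \<le> h (ray p f)"
  shows "eig q k \<le> h (eig p k)"
proof -
  \<comment> \<open>The infimum need not be attained a priori, hence the detour through \<open>t\<close> slightly above it.\<close>
  have upper: "eig q k \<le> h t" if t: "eig p k < t" for t
  proof -
    obtain B where B: "B \<in> genus_family mu p k" "\<And>f. f \<in> B \<Longrightarrow> ray p f \<le> t"
      using eig_lessE[OF pq(1) t] by blast
    have "ray q g \<le> h t" if "g \<in> spow_vec (p / q) ` B" for g
    proof -
      obtain f where f: "f \<in> B" "g = spow_vec (p / q) f"
        using \<open>g \<in> spow_vec (p / q) ` B\<close> by blast
      have fS: "f \<in> p_sphere mu p"
        using f B(1) by (auto simp: genus_family_def)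
      show ?thesis
        using le[OF fS] mono[OF ray_nonneg[OF fS] B(2)[OF f(1)]] f(2) by simp
    qed
    then show ?thesis
      by (intro eig_le[OF pq(2) spow_vec_image_genus_family[of mu, OF mu_pos pq B(1)]])
  qed
  have "(h \<longlongrightarrow> h (eig p k)) (at (eig p k) within {0..})"
    using cont eig_nonneg[OF pq(1)] by (auto simp: continuous_on_def)
  then have "(h \<longlongrightarrow> h (eig p k)) (at_right (eig p k))"
    using eig_nonneg[OF pq(1)] by (elim tendsto_within_subset) auto
  then show ?thesis
  proof (rule tendsto_lowerbound)
    show "\<forall>\<^sub>F t in at_right (eig p k). eig q k \<le> h t"
      using upper by (auto simp: eventually_at_filter)
  qed simp
qed

end

section \<open>First comparison: edgewise estimate with halved gradients\<close>

lemma grad_spow_le: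
  assumes pq: "0 < p" "p \<le> q" and e: "weight e \<noteq> 0"
  shows "\<bar>grad (spow_vec (p / q) f) e\<bar> / 2 \<le> (\<bar>grad f e\<bar> / 2) powr (p / q)"
proof -
  have r: "0 < p / q" "p / q \<le> 1"
    using pq by auto
  show ?thesis
  proof (cases e)
    case (Inl ij)
    obtain i j where ij: "ij = (i, j)" by fastforce
    \<comment> \<open>Nonzero weight means a genuine edge, where the sign is 1 or -1 and commutes
      with \<open>spow\<close>.\<close>
    have "sig i j = 1 \<or> sig i j = -1"
      using e graph by (auto simp: Inl ij weight_def signed_graph_def split: if_splits)
    then show ?thesis
      using spow_diff_le[OF r, of "f$i" "sig i j * f$j"] by (simp add: Inl ij grad_def spow_sign)
  next
    case (Inr i)
    have "\<bar>f$i\<bar> powr (p / q) * 2 powr (p / q) \<le> \<bar>f$i\<bar> powr (p / q) * 2 powr 1"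
      using r by (intro mult_left_mono powr_mono) auto
    then show ?thesis
      by (simp add: Inr grad_def abs_spow powr_divide field_simps)
  qed
qed

text \<open>Raising the edgewise bound to the power \<open>q\<close> leaves \<open>2 powr q\<close>
  against \<open>2 powr p\<close>, which is the source of the factor.\<close>

lemma ray_spow_le:
  assumes pq: "0 < p" "p \<le> q" and f: "f \<in> p_sphere mu p"
  shows "ray q (spow_vec (p / q) f) \<le> 2 powr (q - p) * ray p f"
proof -
  have q: "0 < q" using pq by simp
  have "weight e * \<bar>grad (spow_vec (p / q) f) e\<bar> powr q \<le> 2 powr (q - p) * (weight e * \<bar>grad f e\<bar> powr p)" for e
  proof (cases "weight e = 0")
    case False
    have "(\<bar>grad (spow_vec (p / q) f) e\<bar> / 2) powr q \<le> ((\<bar>grad f e\<bar> / 2) powr (p / q)) powr q"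
      using grad_spow_le[OF pq False] q by (intro powr_mono2) auto
    then have "\<bar>grad (spow_vec (p / q) f) e\<bar> powr q / 2 powr q \<le> \<bar>grad f e\<bar> powr p / 2 powr p"
      using q by (simp add: powr_powr powr_divide)
    then have "\<bar>grad (spow_vec (p / q) f) e\<bar> powr q \<le> 2 powr (q - p) * \<bar>grad f e\<bar> powr p"
      by (simp add: powr_diff field_simps)
    then have "weight e * \<bar>grad (spow_vec (p / q) f) e\<bar> powr q \<le> weight e * (2 powr (q - p) * \<bar>grad f e\<bar> powr p)"
      by (intro mult_left_mono weight_nonneg)
    then show ?thesis by (simp add: mult_ac)
  qed simp
  then show ?thesis
    unfolding ray_on_p_sphere[OF f] ray_on_p_sphere[OF spow_vec_in_p_sphere[OF pq(1) q f]] sum_distrib_left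
    by (intro sum_mono)
qed

section \<open>Second comparison: mean value estimate and Hoelder's inequality\<close>

definition mean_powr :: "real \<Rightarrow> real^'n \<Rightarrow> 'n \<times> 'n + 'n \<Rightarrow> real" where
  "mean_powr q g = case_sum (\<lambda>(i, j). (\<bar>g$i\<bar> powr q + \<bar>g$j\<bar> powr q) / 2) (\<lambda>i. \<bar>g$i\<bar> powr q)"

lemma mean_powr_nonneg: "0 \<le> mean_powr q g e"
  by (auto simp: mean_powr_def split: sum.split)

lemma degD_ge: "kappa i + (\<Sum>j | adj i j. w i j) / 2 \<le> D * mu i"
proof -
  have "(2 * kappa i + (\<Sum>j | adj i j. w i j)) / (2 * mu i) \<le> D"
    unfolding degD_def by (intro Max_ge) auto
  then show ?thesis
    using mu_pos[of i] by (simp add: field_simps)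
qed

lemma degD_nonneg: "0 \<le> D"
proof -
  fix i :: 'n
  have "0 \<le> (\<Sum>j | adj i j. w i j)"
    using graph by (intro sum_nonneg) (auto simp: signed_graph_def less_imp_le)
  then have "0 \<le> D * mu i"
    using degD_ge[of i] kappa[of i] by linarith
  then show ?thesis
    using mu_pos[of i] by (simp add: zero_le_mult_iff)
qed

text \<open>By symmetry each edge gives half its weight to each endpoint, so the coefficient of
  \<open>\<bar>g$i\<bar> powr q\<close> is the numerator of the quotient in \<open>degD\<close>
  divided by 2, at most \<open>D * mu i\<close>.\<close>

lemma sum_weight_mean_powr_le:
  assumes "g \<in> p_sphere mu q"
  shows "(\<Sum>e\<in>UNIV. weight e * mean_powr q g e) \<le> D"
proof -
  let ?a = "\<lambda>i. \<bar>g$i\<bar> powr q"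
  define W where "W = (\<lambda>i j. if adj i j then w i j else 0)"
  have W: "(\<Sum>j | adj i j. w i j * c j) = (\<Sum>j\<in>UNIV. W i j * c j)" for i and c :: "'n \<Rightarrow> real"
    using sum.inter_filter[of UNIV "\<lambda>j. w i j * c j" "adj i"]
    by (simp add: W_def if_distrib[of "\<lambda>x. x * _"] cong: if_cong)
  have sym: "W i j = W j i" for i j
    using graph by (auto simp: W_def signed_graph_def)
  have "(\<Sum>i\<in>UNIV. \<Sum>j\<in>UNIV. W i j * ?a j) = (\<Sum>j\<in>UNIV. \<Sum>i\<in>UNIV. W i j * ?a j)"
    by (rule sum.swap)
  also have "\<dots> = (\<Sum>i\<in>UNIV. \<Sum>j\<in>UNIV. W i j * ?a i)"
    by (intro sum.cong refl) (simp add: sym)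
  finally have swap: "(\<Sum>i\<in>UNIV. \<Sum>j\<in>UNIV. W i j * ?a j) = (\<Sum>i\<in>UNIV. \<Sum>j\<in>UNIV. W i j * ?a i)" .
  have "(\<Sum>i\<in>UNIV. \<Sum>j | adj i j. w i j * ((?a i + ?a j) / 2))
      = ((\<Sum>i\<in>UNIV. \<Sum>j\<in>UNIV. W i j * ?a i) + (\<Sum>i\<in>UNIV. \<Sum>j\<in>UNIV. W i j * ?a j)) / 2"
    unfolding W sum.distrib[symmetric] sum_divide_distrib
    by (intro sum.cong refl) (simp add: algebra_simps add_divide_distrib)
  also have "\<dots> = (\<Sum>i\<in>UNIV. (\<Sum>j | adj i j. w i j) * ?a i)"
    unfolding swap using W[of _ "\<lambda>_. 1"] by (simp add: sum_distrib_right)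
  finally have "(\<Sum>e\<in>UNIV. weight e * mean_powr q g e)
      = (\<Sum>i\<in>UNIV. (kappa i + (\<Sum>j | adj i j. w i j) / 2) * ?a i)"
    unfolding sum_weight
    by (simp add: mean_powr_def distrib_right sum.distrib sum_divide_distrib[of _ UNIV])
  also have "\<dots> \<le> (\<Sum>i\<in>UNIV. (D * mu i) * ?a i)"
    by (intro sum_mono mult_right_mono degD_ge) auto
  also have "\<dots> = D"
    using assms by (simp add: p_sphere_def mult.assoc flip: sum_distrib_left)
  finally show ?thesis .
qed

lemma grad_spow_le_mean:
  assumes pq: "1 < p" "p < q" and e: "weight e \<noteq> 0"
  shows "\<bar>grad (spow_vec (q / p) g) e\<bar> \<le> (q / p) * \<bar>grad g e\<bar> * mean_powr q g e powr (1/p - 1/q)"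
proof (cases e)
  case (Inl ij)
  obtain i j where ij: "ij = (i, j)" by fastforce
  have sig: "sig i j = 1 \<or> sig i j = -1"
    using e graph by (auto simp: Inl ij weight_def signed_graph_def split: if_splits)
  then have "\<bar>sig i j * g$j\<bar> = \<bar>g$j\<bar>" by auto
  with sig show ?thesis
    using spow_diff_le_mean[OF pq, of "g$i" "sig i j * g$j"]
    by (simp add: Inl ij grad_def mean_powr_def spow_sign)
next
  case (Inr i)
  \<comment> \<open>At a vertex the bound is an identity up to the factor
    \<open>q / p \<ge> 1\<close>.\<close>
  have "\<bar>g$i\<bar> powr (q / p) = \<bar>g$i\<bar> powr (1 + q * (1/p - 1/q))"
    using pq by (simp add: right_diff_distrib)
  also have "\<dots> = \<bar>g$i\<bar> * (\<bar>g$i\<bar> powr q) powr (1/p - 1/q)"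
    by (cases "g$i = 0") (simp_all add: powr_add powr_powr)
  also have "\<dots> \<le> (q / p) * (\<bar>g$i\<bar> * (\<bar>g$i\<bar> powr q) powr (1/p - 1/q))"
  proof -
    have "1 \<le> q / p" using pq by simp
    from mult_right_mono[OF this, of "\<bar>g$i\<bar> * (\<bar>g$i\<bar> powr q) powr (1/p - 1/q)"]
    show ?thesis by simp
  qed
  finally show ?thesis
    by (simp add: Inr grad_def abs_spow mean_powr_def mult.assoc)
qed

text \<open>Hoelder with exponents \<open>p/q\<close> and \<open>1 - p/q\<close> separates the
  energy of \<open>g\<close> from the sum of means, and the latter is at most
  \<open>D\<close>.\<close>

lemma ray_spow_le_mean:
  assumes pq: "1 < p" "p < q" and g: "g \<in> p_sphere mu q"
  shows "ray p (spow_vec (q / p) g) \<le> (q / p) powr p * ray q g powr (p / q) * D powr (1 - p / q)"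
proof -
  let ?t = "p / q"
  have pos: "0 < p" "0 < q" and t: "0 < ?t" "?t < 1" using pq by auto
  have exp: "p * (1/p - 1/q) = 1 - ?t"
    using pos by (simp add: right_diff_distrib)
  have "weight e * \<bar>grad (spow_vec (q / p) g) e\<bar> powr p
      \<le> (q / p) powr p * (weight e * ((\<bar>grad g e\<bar> powr q) powr ?t * mean_powr q g e powr (1 - ?t)))" for e
  proof (cases "weight e = 0")
    case False
    have "\<bar>grad (spow_vec (q / p) g) e\<bar> powr p
        \<le> ((q / p) * \<bar>grad g e\<bar> * mean_powr q g e powr (1/p - 1/q)) powr p"
      using grad_spow_le_mean[OF pq False] pos by (intro powr_mono2) auto
    also have "\<dots> = (q / p) powr p * ((\<bar>grad g e\<bar> powr q) powr ?t * mean_powr q g e powr (1 - ?t))"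
    proof -
      have "(mean_powr q g e powr (1/p - 1/q)) powr p = mean_powr q g e powr (1 - ?t)"
        by (subst powr_powr) (simp only: mult.commute[of _ p] exp)
      moreover have "(\<bar>grad g e\<bar> powr q) powr ?t = \<bar>grad g e\<bar> powr p"
        using pos by (simp add: powr_powr)
      ultimately show ?thesis
        using pos by (simp only: powr_mult mult.assoc)
    qed
    finally have "weight e * \<bar>grad (spow_vec (q / p) g) e\<bar> powr p
        \<le> weight e * ((q / p) powr p * ((\<bar>grad g e\<bar> powr q) powr ?t * mean_powr q g e powr (1 - ?t)))"
      by (intro mult_left_mono weight_nonneg)
    then show ?thesis by (simp add: mult_ac)
  qed simp
  then have "ray p (spow_vec (q / p) g)
      \<le> (q / p) powr p * (\<Sum>e\<in>UNIV. weight e * ((\<bar>grad g e\<bar> powr q) powr ?t * mean_powr q g e powr (1 - ?t)))"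
    unfolding ray_on_p_sphere[OF spow_vec_in_p_sphere[OF pos(2,1) g]] sum_distrib_left
    by (intro sum_mono)
  also have "\<dots> \<le> (q / p) powr p * ((\<Sum>e\<in>UNIV. weight e * \<bar>grad g e\<bar> powr q) powr ?t
      * (\<Sum>e\<in>UNIV. weight e * mean_powr q g e) powr (1 - ?t))"
    using t by (intro mult_left_mono sum_Holder_powr weight_nonneg mean_powr_nonneg) auto
  also have "\<dots> \<le> (q / p) powr p * (ray q g powr ?t * D powr (1 - ?t))"
  proof -
    have "(\<Sum>e\<in>UNIV. weight e * mean_powr q g e) powr (1 - ?t) \<le> D powr (1 - ?t)"
      using t sum_weight_mean_powr_le[OF g]
      by (intro powr_mono2 sum_nonneg mult_nonneg_nonneg weight_nonneg mean_powr_nonneg) auto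
    then show ?thesis
      unfolding ray_on_p_sphere[OF g] by (intro mult_left_mono) auto
  qed
  finally show ?thesis
    by (simp add: mult.assoc)
qed

section \<open>The two eigenvalue inequalities\<close>

lemma eig_scaled_antimono:
  assumes "1 \<le> k" "k \<le> CARD('n)" and pq: "0 < p" "p \<le> q"
  shows "2 powr (-q) * eig q k \<le> 2 powr (-p) * eig p k"
proof -
  have "eig q k \<le> 2 powr (q - p) * eig p k"
  proof (rule eig_transfer[OF assms(1,2)])
    show "ray q (spow_vec (p / q) f) \<le> 2 powr (q - p) * ray p f" if "f \<in> p_sphere mu p" for f
      using that by (rule ray_spow_le[OF pq])
  qed (use pq in \<open>auto intro!: continuous_intros\<close>)
  then have "2 powr (-q) * eig q k \<le> 2 powr (-q) * (2 powr (q - p) * eig p k)"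
    by (intro mult_left_mono) auto
  also have "\<dots> = 2 powr (-p) * eig p k"
    by (simp flip: powr_add mult.assoc)
  finally show ?thesis .
qed

lemma eig_normalized_mono:
  assumes k: "1 \<le> k" "k \<le> CARD('n)" and pq: "1 < p" "p \<le> q"
  shows "p * (eig p k / D) powr (1/p) \<le> q * (eig q k / D) powr (1/q)"
\<comment> \<open>If \<open>D = 0\<close>, both quotients are \<open>x / 0 = 0\<close> and both
  sides vanish; if \<open>p = q\<close>, the sides coincide.\<close>
proof (cases "p = q \<or> D = 0")
  case False
  then have pq': "1 < p" "p < q" and D: "D > 0"
    using pq degD_nonneg by auto
  have pos: "0 < p" "0 < q" using pq by auto
  let ?h = "\<lambda>x. (q / p) powr p * x powr (p / q) * D powr (1 - p / q)"
  have "eig p k \<le> ?h (eig q k)"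
  \<comment> \<open>The exponents are swapped: competitors travel from the \<open>q\<close>-sphere
    to the \<open>p\<close>-sphere.\<close>
  proof (rule eig_transfer[OF k pos(2,1)])
    show "ray p (spow_vec (q / p) g) \<le> ?h (ray q g)" if "g \<in> p_sphere mu q" for g
      using that by (rule ray_spow_le_mean[OF pq'])
    show "?h x \<le> ?h y" if "0 \<le> x" "x \<le> y" for x y
      using that pos by (intro mult_right_mono mult_left_mono powr_mono2) auto
    show "continuous_on {0..} ?h"
      using pos by (intro continuous_on_mult continuous_on_const continuous_on_powr' continuous_on_id) auto
  qed
  then have "eig p k / D \<le> ?h (eig q k) / D"
    using D by (intro divide_right_mono) auto
  \<comment> \<open>Dividing \<open>D powr (1 - p/q)\<close> by \<open>D\<close> leaves
    \<open>D powr (- p/q)\<close>, which normalizes \<open>eig q k\<close>.\<close>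
  also have "\<dots> = (q / p) powr p * (eig q k / D) powr (p / q)"
    using D by (simp add: powr_divide powr_diff)
  finally have "(eig p k / D) powr (1/p) \<le> ((q / p) powr p * (eig q k / D) powr (p / q)) powr (1/p)"
    using D pos eig_nonneg[OF k pos(1)] by (intro powr_mono2) auto
  also have "\<dots> = (q / p) * (eig q k / D) powr (1/q)"
    using pos by (simp add: powr_mult powr_powr)
  finally have "p * (eig p k / D) powr (1/p) \<le> p * ((q / p) * (eig q k / D) powr (1/q))"
    using pos by (intro mult_left_mono) auto
  then show ?thesis
    using pos by simp
qed auto

end

theorem theorem3p1:
  fixes adj :: "'n::finite \<Rightarrow> 'n \<Rightarrow> bool"
    and sig w :: "'n \<Rightarrow> 'n \<Rightarrow> real"
    and mu kappa :: "'n \<Rightarrow> real"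
    and p q :: real and k :: nat
  assumes "signed_graph adj sig w mu"
    and "\<forall>i. kappa i \<ge> 0"
    and "1 < p" and "p \<le> q"
    and "1 \<le> k" and "k \<le> CARD('n)"
  shows "2 powr (-p) * var_eig adj sig w mu kappa p k \<ge> 2 powr (-q) * var_eig adj sig w mu kappa q k
       \<and> p * (var_eig adj sig w mu kappa p k / degD adj w mu kappa) powr (1/p)
         \<le> q * (var_eig adj sig w mu kappa q k / degD adj w mu kappa) powr (1/q)"
proof -
  interpret potential_signed_graph adj sig w mu kappa
    using assms(1,2) by unfold_locales auto
  show ?thesis
    using assms eig_scaled_antimono[of k p q] eig_normalized_mono[of k p q] by simp
qed

end
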